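(* Let $j\in\mathbb{N}$ with $j\ge 2$, and let $\beta$ be an angle with $0<\beta<\pi/j$. Let $W$ be a path in $\mathbb{R}^2$, and let $P$ be the path obtained by first traversing $W$ from its start to its end and then traversing, backwards (from its end to its start), the copy of $W$ rotated by the angle $\beta$ (in either sense) about the endpoint of $W$. Suppose that 1. $W$ is not a $1$-path, i.e. $R(W,r)\neq\mathbf 1$ for all $r>0$; and 2. for no $r>0$ is $R(W,r)$ a rotation about the axis perpendicular to the plane of the path. Then $P$ is an $n$-path for some $n>j$.
   Context: **Paths.** A path is a finite curve in $\mathbb{R}^2$ given by a continuous map $\gamma:[0,1]\to\mathbb{R}^2$ that is piecewise $C^{1,\delta}$ for some $\delta\in(0,1]$. This means that $[0,1]$ can be divided into finitely many closed subintervals, on each of which $\gamma$ is differentiable with $\delta$-Hölder continuous derivative $\dot\gamma$. Corners, and in particular polygonal paths, are allowed. **Rolling.** Identify $\mathbb{R}^2$ with the horizontal plane $z=0$ in $\mathbb{R}^3$, and let $\hat z=(0,0,1)$. For a path $P$ given by $\gamma$ and for $r>0$, a ball of radius $r$ resting on the plane rolls along $P$ without slipping and without pivoting (no rotation about the vertical axis), with its contact point in the plane tracing $\gamma$. Its orientation $Q(t)\in SO(3)$, $t\in[0,1]$, is the continuous solution of $$\dot Q(t)=\Omega(t)\,Q(t),\qquad Q(0)=\mathbf 1,$$ where the differential equation holds on each smooth piece of $\gamma$, and $\Omega(t)$ is the skew-symmetric matrix $x\mapsto \omega(t)\times x$ with $\omega(t)=\frac1r\,\hat z\times\dot\gamma(t)$.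 Define $R(P,r)=Q(1)\in SO(3)$. It does not depend on the (orientation-preserving) parametrization. If $P$ is repeated periodically by concatenating translated copies (each copy translated by the vector from the start to the end of $P$), then the rotation after rolling over $k$ consecutive copies is $R(P,r)^k$. The total motion over $k$ copies is a pure translation if and only if $R(P,r)^k=\mathbf 1$. **$n$-paths.** The path $P$ is kept fixed and the radius $r>0$ is free. For $n\in\mathbb{N}$, $n\ge1$, the path $P$ is called an $n$-path if $n$ is the smallest positive integer $k$ for which there exists $r>0$ with $R(P,r)^k=\mathbf 1$. In other words, for some radius a pure translation is reached after rolling over $n$ copies of $P$, and for no radius is a pure translation reached after rolling over fewer than $n$ copies. *)

theory Defs
  imports "HOL-Analysis.Analysis"
begin

text \<open>Paths: curves on \<open>[0,1]\<close> that are piecewise \<open>C\<^sup>1\<^sup>,\<^sup>\<delta>\<close>. On each closed piece the derivative is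
  one-sided at the two end points, so corners are allowed; the derivative may vanish.\<close>

definition holder_C1_on :: "real \<Rightarrow> real set \<Rightarrow> (real \<Rightarrow> real^2) \<Rightarrow> bool" where
  "holder_C1_on \<delta> S \<gamma> \<longleftrightarrow>
     (\<exists>\<gamma>'. (\<forall>t\<in>S. (\<gamma> has_vector_derivative \<gamma>' t) (at t within S)) \<and>
           (\<exists>C. \<forall>s\<in>S. \<forall>t\<in>S. norm (\<gamma>' s - \<gamma>' t) \<le> C * \<bar>s - t\<bar> powr \<delta>))"

definition piecewise_holder_path :: "(real \<Rightarrow> real^2) \<Rightarrow> bool" where
  "piecewise_holder_path \<gamma> \<longleftrightarrow>
     path \<gamma> \<and>
     (\<exists>\<delta>. 0 < \<delta> \<and> \<delta> \<le> 1 \<and>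
        (\<exists>m p. p 0 = 0 \<and> p m = 1 \<and>
           (\<forall>i<m. p i < p (Suc i) \<and> holder_C1_on \<delta> {p i..p (Suc i)} \<gamma>)))"

definition smooth_piece :: "(real \<Rightarrow> real^2) \<Rightarrow> real \<Rightarrow> real \<Rightarrow> bool" where
  "smooth_piece \<gamma> a b \<longleftrightarrow>
     0 \<le> a \<and> a < b \<and> b \<le> 1 \<and> (\<exists>\<delta>. 0 < \<delta> \<and> \<delta> \<le> 1 \<and> holder_C1_on \<delta> {a..b} \<gamma>)"

definition zhat :: "real^3" where
  "zhat = vector [0, 0, 1]"

definition embed_plane :: "real^2 \<Rightarrow> real^3" where
  "embed_plane v = vector [v $ 1, v $ 2, 0]"

text \<open>The matrix of \<open>x \<mapsto> \<omega> \<times> x\<close>, where \<open>\<omega> = (1/r) zhat \<times> v\<close> is the angular velocity of the ball of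
  radius \<open>r\<close> when its contact point has velocity \<open>v\<close>.\<close>

definition angular_velocity_matrix :: "real \<Rightarrow> real^2 \<Rightarrow> real^3^3" where
  "angular_velocity_matrix r v = matrix (cross3 ((1 / r) *\<^sub>R cross3 zhat (embed_plane v)))"

definition rolling_orientation :: "(real \<Rightarrow> real^2) \<Rightarrow> real \<Rightarrow> (real \<Rightarrow> real^3^3) \<Rightarrow> bool" where
  "rolling_orientation \<gamma> r Q \<longleftrightarrow>
     continuous_on {0..1} Q \<and>
     (\<forall>t\<in>{0..1}. rotation_matrix (Q t)) \<and>
     Q 0 = mat 1 \<and>
     (\<forall>a b. smooth_piece \<gamma> a b \<longrightarrow>
        (\<forall>t\<in>{a..b}.
           (Q has_vector_derivative
              angular_velocity_matrix r (vector_derivative \<gamma> (at t within {a..b})) ** Q t)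
           (at t within {a..b})))"

text \<open>For a piecewise \<open>C\<^sup>1\<^sup>,\<^sup>\<delta>\<close> path the orientation on \<open>[0,1]\<close> exists and is unique; its values
  outside \<open>[0,1]\<close> are unconstrained, so the final value is described rather than the function.\<close>

definition rolling_rotation :: "(real \<Rightarrow> real^2) \<Rightarrow> real \<Rightarrow> real^3^3" where
  "rolling_rotation \<gamma> r = (THE A. \<exists>Q. rolling_orientation \<gamma> r Q \<and> A = Q 1)"

text \<open>Powers with respect to the matrix product; the library's \<open>*\<close> and \<open>1\<close> on \<open>real^3^3\<close> are
  componentwise.\<close>

definition matrix_pow :: "real^3^3 \<Rightarrow> nat \<Rightarrow> real^3^3" where
  "matrix_pow A k = (((**) A) ^^ k) (mat 1)"

definition n_path :: "nat \<Rightarrow> (real \<Rightarrow> real^2) \<Rightarrow> bool" where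
  "n_path n \<gamma> \<longleftrightarrow>
     piecewise_holder_path \<gamma> \<and>
     1 \<le> n \<and>
     (\<exists>r>0. matrix_pow (rolling_rotation \<gamma> r) n = mat 1) \<and>
     (\<forall>k. 1 \<le> k \<and> k < n \<longrightarrow> \<not> (\<exists>r>0. matrix_pow (rolling_rotation \<gamma> r) k = mat 1))"

definition rotation_about_z :: "real \<Rightarrow> real^3^3" where
  "rotation_about_z \<theta> =
     vector [vector [cos \<theta>, - sin \<theta>, 0],
             vector [sin \<theta>, cos \<theta>, 0],
             vector [0, 0, 1]]"

definition rotate_plane_about :: "real^2 \<Rightarrow> real \<Rightarrow> real^2 \<Rightarrow> real^2" where
  "rotate_plane_about c \<theta> x =
     c + (vector [vector [cos \<theta>, - sin \<theta>], vector [sin \<theta>, cos \<theta>]] :: real^2^2) *v (x - c)"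

definition there_and_rotated_back :: "real \<Rightarrow> (real \<Rightarrow> real^2) \<Rightarrow> real \<Rightarrow> real^2" where
  "there_and_rotated_back \<theta> W =
     W +++ reversepath (rotate_plane_about (pathfinish W) \<theta> \<circ> W)"

end

(* Write A = R(W,r) and Z for the rotation by phi about the vertical axis. Rolling along the rotated
   copy of W conjugates A by Z, and rolling backwards inverts, so R(P,r) = Z A^T Z^T A. This
   commutator is a rotation by an angle 2 alpha with
     cos alpha = (1 + cos beta)/2 + (1 - cos beta)/2 * A33.
   As A is never a rotation about the vertical axis, A33 < 1, so 0 < alpha <= beta < pi/j, and no power
   k <= j of R(P,r) is the identity. On the other hand A is Lipschitz in 1/r and tends to 1 as r grows,
   so alpha takes all small positive values, among them pi/n for all large n; for this value
   R(P,r)^n = 1. *)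
theory Submission
  imports Defs
begin

text \<open>\<open>rolling_rotation\<close> is a definite description, so nothing can be computed
  with it before existence and uniqueness of the orientation are known. Its equation is imposed on
  every smooth piece, with one-sided derivatives at the ends, which is awkward to verify for an
  orientation glued from two halves. The constructions therefore work with solutions off a finite
  set, and the two notions are related once for all paths. One identity carries most of the
  analysis: for solutions Q, R with radii r, s, the derivative of Q^T R is 1/s - 1/r times a bounded
  factor. Equal radii give orthogonality and uniqueness, different radii give the Lipschitz
  estimate. On the algebraic side the trace alone decides which powers of a rotation are the
  identity, so the axis of the commutator never has to be found. This criterion excludes half turns;
  j \<ge> 2 keeps 2 \<alpha> below \<pi>.\<close>

section \<open>Linear differential equations with continuous coefficients\<close>

text \<open>The solution is the series of iterated integrals. The factorial in the bound on its
  terms makes it converge on the whole interval at once, whatever the size of \<open>B\<close>, so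
  no short intervals have to be patched together.\<close>

lemma linear_ode_exists:
  fixes prod :: "'b::banach \<Rightarrow> 'a::banach \<Rightarrow> 'a" and B :: "real \<Rightarrow> 'b" and X :: 'a
  assumes bil: "bounded_bilinear prod" and cont: "continuous_on {a..b} B"
  obtains Q where "Q a = X"
    and "\<And>t. t \<in> {a..b} \<Longrightarrow>
           (Q has_vector_derivative prod (B t) (Q t)) (at t within {a..b})"
proof -
  interpret bounded_bilinear prod by (fact bil)
  obtain K where K: "K > 0" "\<And>x y. norm (prod x y) \<le> norm x * norm y * K"
    using pos_bounded by blast
  have "bounded (B ` {a..b})"
    using cont compact_continuous_image compact_imp_bounded by blast
  then obtain C where C: "C > 0" "\<And>t. t \<in> {a..b} \<Longrightarrow> norm (B t) \<le> C"
    unfolding bounded_pos by auto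
  define L where "L = C * K"
  have L: "L > 0" using C K by (simp add: L_def)
  have prod_le: "norm (prod (B t) y) \<le> L * norm y" if "t \<in> {a..b}" for t y
  proof -
    have "norm (prod (B t) y) \<le> norm (B t) * norm y * K" by (rule K)
    also have "\<dots> \<le> C * norm y * K" using C(2)[OF that] K(1) by (intro mult_right_mono) auto
    finally show ?thesis by (simp add: L_def mult_ac)
  qed
  \<comment> \<open>Each term is the integral of the equation's right-hand side at the preceding
    term, so the sum reproduces itself under integration, up to the initial value.\<close>
  define f where "f = rec_nat (\<lambda>t. X) (\<lambda>n g t. integral {a..t} (\<lambda>s. prod (B s) (g s)))"
  have f0: "f 0 t = X" and fS: "f (Suc n) t = integral {a..t} (\<lambda>s. prod (B s) (f n s))" for n t
    by (simp_all add: f_def)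
  have cf: "continuous_on {a..b} (f n)" for n
  proof (induction n)
    case (Suc n)
    have "(\<lambda>s. prod (B s) (f n s)) integrable_on {a..b}"
      by (intro integrable_continuous_real continuous_on cont Suc)
    then have "continuous_on {a..b} (\<lambda>t. integral {a..t} (\<lambda>s. prod (B s) (f n s)))"
      by (rule indefinite_integral_continuous_1)
    then show ?case by (simp add: fS[abs_def])
  qed (simp add: f0[abs_def])
  have int: "(\<lambda>s. prod (B s) (g s)) integrable_on {a..t}"
    if "continuous_on {a..b} g" "t \<in> {a..b}" for g t
    by (rule integrable_continuous_real, rule continuous_on_subset[of "{a..b}"])
       (use that in \<open>auto intro!: continuous_on cont\<close>)
  have bound: "t \<in> {a..b} \<Longrightarrow> norm (f n t) \<le> norm X * (L * (t - a)) ^ n / fact n" for n t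
  proof (induction n arbitrary: t)
    case (Suc n)
    let ?h = "\<lambda>s. norm X * (L * (s - a)) ^ Suc n / fact (Suc n)"
    let ?h' = "\<lambda>s. L * (norm X * (L * (s - a)) ^ n / fact n)"
    have h: "(?h' has_integral ?h t - ?h a) {a..t}"
    proof (rule fundamental_theorem_of_calculus)
      fix s
      have fs: "fact (Suc n) = (1 + real n) * (fact n :: real)" by simp
      have "(?h has_real_derivative ?h' s) (at s within {a..t})"
        unfolding fs by (rule derivative_eq_intros refl | simp)+
      then show "(?h has_vector_derivative ?h' s) (at s within {a..t})"
        by (simp add: has_real_derivative_iff_has_vector_derivative)
    qed (use Suc in auto)
    have "norm (f (Suc n) t) \<le> integral {a..t} ?h'"
      unfolding fS
    proof (rule integral_norm_bound_integral)
      show "(\<lambda>s. prod (B s) (f n s)) integrable_on {a..t}" using int cf Suc.prems by blast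
      show "?h' integrable_on {a..t}" using h by blast
      fix s assume s: "s \<in> {a..t}"
      then have s': "s \<in> {a..b}" using Suc.prems by auto
      show "norm (prod (B s) (f n s)) \<le> ?h' s"
        using prod_le[OF s', of "f n s"] mult_left_mono[OF Suc.IH[OF s'], of L] L by linarith
    qed
    also have "\<dots> = ?h t - ?h a" by (rule integral_unique[OF h])
    also have "?h a = 0" by simp
    finally show ?case by (simp only: diff_0_right)
  qed (simp add: f0)
  define M where "M n = norm X * ((L * (b - a)) ^ n / fact n)" for n
  have sM: "summable M"
    unfolding M_def using summable_exp_generic[of "L * (b - a)"]
    by (intro summable_mult) (simp add: field_simps)
  have "norm (f n t) \<le> M n" if "t \<in> {a..b}" for n t
  proof -
    have "(L * (t - a)) ^ n \<le> (L * (b - a)) ^ n"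
      using that L by (intro power_mono) auto
    then have "norm X * (L * (t - a)) ^ n / fact n \<le> norm X * (L * (b - a)) ^ n / fact n"
      by (intro divide_right_mono mult_left_mono) auto
    then show ?thesis using bound[OF that, of n] by (simp add: M_def)
  qed
  then have ul: "uniform_limit {a..b} (\<lambda>n t. \<Sum>i<n. f i t) (\<lambda>t. \<Sum>i. f i t) sequentially"
    using sM by (rule Weierstrass_m_test)
  define Q where "Q = (\<lambda>t. \<Sum>i. f i t)"
  have cS: "continuous_on {a..b} (\<lambda>t. \<Sum>i<n. f i t)" for n
    by (intro continuous_on_sum cf)
  have cQ: "continuous_on {a..b} Q"
    unfolding Q_def by (rule uniform_limit_theorem[OF _ ul]) (auto intro: always_eventually cS)
  \<comment> \<open>The partial sums satisfy the integral equation with the index shifted by one;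
    uniform convergence carries it to the limit.\<close>
  have QI: "Q t = X + integral {a..t} (\<lambda>s. prod (B s) (Q s))" if t: "t \<in> {a..b}" for t
  proof -
    have Sum: "(\<Sum>i<Suc n. f i t) = X + integral {a..t} (\<lambda>s. prod (B s) (\<Sum>i<n. f i s))" for n
    proof -
      have "(\<Sum>i<Suc n. f i t) = X + (\<Sum>i<n. integral {a..t} (\<lambda>s. prod (B s) (f i s)))"
        by (simp only: sum.lessThan_Suc_shift f0 fS)
      also have "(\<Sum>i<n. integral {a..t} (\<lambda>s. prod (B s) (f i s)))
          = integral {a..t} (\<lambda>s. prod (B s) (\<Sum>i<n. f i s))"
        unfolding sum_right by (rule integral_sum[symmetric]) (auto intro: int cf t)
      finally show ?thesis .
    qed
    have "uniform_limit {a..b} (\<lambda>n s. prod (B s) (\<Sum>i<n. f i s)) (\<lambda>s. prod (B s) (Q s)) sequentially"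
      using ul cQ cont unfolding Q_def
      by (intro bounded_uniform_limit uniform_limit_const)
         (auto intro!: compact_imp_bounded compact_continuous_image)
    then have "uniform_limit {a..t} (\<lambda>n s. prod (B s) (\<Sum>i<n. f i s)) (\<lambda>s. prod (B s) (Q s)) sequentially"
      by (rule uniform_limit_on_subset) (use t in auto)
    then obtain I J where I: "\<And>n. ((\<lambda>s. prod (B s) (\<Sum>i<n. f i s)) has_integral I n) {a..t}"
      and J: "((\<lambda>s. prod (B s) (Q s)) has_integral J) {a..t}" "(I \<longlongrightarrow> J) sequentially"
      by (rule uniform_limit_integral)
         (use t in \<open>auto intro!: continuous_on continuous_on_subset[OF cont] continuous_on_subset[OF cS]\<close>)
    have "(\<lambda>n. \<Sum>i<Suc n. f i t) \<longlonglongrightarrow> X + integral {a..t} (\<lambda>s. prod (B s) (Q s))"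
      unfolding Sum integral_unique[OF I] integral_unique[OF J(1)] by (intro tendsto_intros J(2))
    moreover have "(\<lambda>n. \<Sum>i<Suc n. f i t) \<longlonglongrightarrow> Q t"
      using tendsto_uniform_limitI[OF ul t] unfolding Q_def by (rule LIMSEQ_Suc)
    ultimately show ?thesis using LIMSEQ_unique by blast
  qed
  \<comment> \<open>\<open>R\<close> agrees with \<open>Q\<close> on the interval by
    \<open>QI\<close>, but is an indefinite integral by definition, so it can be differentiated
    directly, also at the end points.\<close>
  define R where "R t = X + integral {a..t} (\<lambda>s. prod (B s) (Q s))" for t
  show thesis
  proof
    show "R a = X" by (simp add: R_def)
    fix t assume t: "t \<in> {a..b}"
    have "(R has_vector_derivative 0 + prod (B t) (Q t)) (at t within {a..b})"
      unfolding R_def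
      by (intro has_vector_derivative_add integral_has_vector_derivative
          has_vector_derivative_const continuous_on cont cQ t)
    then show "(R has_vector_derivative prod (B t) (R t)) (at t within {a..b})"
      using QI[OF t] by (simp add: R_def)
  qed
qed

section \<open>Matrix products and rotation matrices\<close>

lemma bounded_bilinear_matrix_matrix_mult:
  "bounded_bilinear ((**) :: real^'n^'m \<Rightarrow> real^'p^'n \<Rightarrow> real^'p^'m)"
proof -
  have "bilinear ((**) :: real^'n^'m \<Rightarrow> real^'p^'n \<Rightarrow> real^'p^'m)"
    unfolding bilinear_def
    by (auto intro!: linearI simp: matrix_matrix_mult_def vec_eq_iff sum.distrib algebra_simps
        sum_distrib_left)
  then show ?thesis by (simp add: bilinear_conv_bounded_bilinear)
qed

interpretation matrix_mult: bounded_bilinear "(**) :: real^'n^'m \<Rightarrow> real^'p^'n \<Rightarrow> real^'p^'m"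
  by (rule bounded_bilinear_matrix_matrix_mult)

lemma bounded_linear_transpose: "bounded_linear (transpose :: real^'n^'m \<Rightarrow> real^'m^'n)"
  by (simp add: linear_conv_bounded_linear[symmetric] linear_iff transpose_def vec_eq_iff)

lemma rotation_matrix_transpose:
  fixes A :: "real^'n^'n"
  assumes "rotation_matrix A"
  shows "rotation_matrix (transpose A)"
  using assms by (simp add: rotation_matrix_def orthogonal_matrix_transpose det_transpose)

lemma rotation_matrix_inverse:
  fixes A :: "real^'n^'n"
  assumes "rotation_matrix A"
  shows "transpose A ** A = mat 1" "A ** transpose A = mat 1"
  using assms by (simp_all add: rotation_matrix_def orthogonal_matrix_def)

lemma rotation_matrix_about_z: "rotation_matrix (rotation_about_z \<theta>)"
proof -
  have "cos \<theta> * cos \<theta> + sin \<theta> * sin \<theta> = 1"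
    using sin_cos_squared_add2[of \<theta>] by (simp add: power2_eq_square)
  then show ?thesis
    by (simp add: rotation_matrix_def orthogonal_matrix det_3 rotation_about_z_def vec_eq_iff
        matrix_matrix_mult_def transpose_def mat_def sum_3 forall_3 algebra_simps)
qed

lemma rotation_matrix_row_col:
  fixes A :: "real^3^3"
  assumes "rotation_matrix A"
  shows "(A$i$1)^2 + (A$i$2)^2 + (A$i$3)^2 = 1" "(A$1$i)^2 + (A$2$i)^2 + (A$3$i)^2 = 1"
proof -
  have "(A ** transpose A) $ i $ i = 1" "(transpose A ** A) $ i $ i = 1"
    using rotation_matrix_inverse[OF assms] by (simp_all add: mat_def)
  then show "(A$i$1)^2 + (A$i$2)^2 + (A$i$3)^2 = 1" "(A$1$i)^2 + (A$2$i)^2 + (A$3$i)^2 = 1"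
    by (simp_all add: matrix_matrix_mult_def transpose_def sum_3 power2_eq_square)
qed

lemma rotation_matrix_entry_le:
  fixes A :: "real^3^3"
  assumes "rotation_matrix A"
  shows "\<bar>A $ i $ j\<bar> \<le> 1"
proof -
  have "(A $ i $ j)^2 \<le> 1"
    using rotation_matrix_row_col(1)[OF assms, of i] exhaust_3[of j]
      zero_le_power2[of "A$i$1"] zero_le_power2[of "A$i$2"] zero_le_power2[of "A$i$3"]
    by (elim disjE; hypsubst; linarith)
  then show ?thesis by (simp add: abs_square_le_1)
qed

text \<open>The true value is the square root of 3. The Lipschitz estimate below only asks for a
  bound common to all rotations, so each of the nine entries is estimated by 1.\<close>

lemma rotation_matrix_norm_le:
  fixes A :: "real^3^3"
  assumes "rotation_matrix A"
  shows "norm A \<le> 9"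
proof -
  have "norm (A $ i) \<le> 3" for i
  proof -
    have "norm (A $ i) \<le> (\<Sum>j\<in>UNIV. \<bar>A $ i $ j\<bar>)" by (rule norm_le_l1_cart)
    also have "\<dots> \<le> (\<Sum>j\<in>(UNIV::3 set). 1)"
      by (intro sum_mono) (simp add: rotation_matrix_entry_le[OF assms])
    finally show ?thesis by simp
  qed
  then have "(\<Sum>i\<in>UNIV. norm (A $ i)) \<le> (\<Sum>i\<in>(UNIV::3 set). 3)" by (intro sum_mono)
  moreover have "norm A \<le> (\<Sum>i\<in>UNIV. norm (A $ i))"
    by (simp add: norm_vec_def L2_set_le_sum)
  ultimately show ?thesis by simp
qed

text \<open>A rotation preserves cross products, hence equals its own cofactor matrix; applying this
  to pairs of basis vectors gives the diagonal entries.\<close>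

lemma rotation_matrix_minors:
  fixes A :: "real^3^3"
  assumes "rotation_matrix A"
  shows "A$2$2 * A$3$3 - A$2$3 * A$3$2 = A$1$1"
    and "A$1$1 * A$3$3 - A$1$3 * A$3$1 = A$2$2"
    and "A$1$1 * A$2$2 - A$1$2 * A$2$1 = A$3$3"
proof -
  note c = cross_rotation_matrix[OF assms]
  show "A$2$2 * A$3$3 - A$2$3 * A$3$2 = A$1$1"
    using arg_cong[OF c[of "vector [0,1,0]" "vector [0,0,1]"], of "\<lambda>v. v $ 1"]
    by (simp add: cross3_def matrix_vector_mult_def sum_3 algebra_simps)
  show "A$1$1 * A$3$3 - A$1$3 * A$3$1 = A$2$2"
    using arg_cong[OF c[of "vector [0,0,1]" "vector [1,0,0]"], of "\<lambda>v. v $ 2"]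
    by (simp add: cross3_def matrix_vector_mult_def sum_3 algebra_simps)
  show "A$1$1 * A$2$2 - A$1$2 * A$2$1 = A$3$3"
    using arg_cong[OF c[of "vector [1,0,0]" "vector [0,1,0]"], of "\<lambda>v. v $ 3"]
    by (simp add: cross3_def matrix_vector_mult_def sum_3 algebra_simps)
qed

text \<open>Rows and columns are unit vectors, so the entry 1 clears the rest of the third row and
  column and leaves a plane rotation. This converts the hypothesis on the axis of \<open>W\<close>
  into a strict bound on the (3,3) entry.\<close>

lemma rotation_matrix_fixing_z:
  fixes A :: "real^3^3"
  assumes rot: "rotation_matrix A" and 33: "A $ 3 $ 3 = 1"
  obtains \<theta> where "A = rotation_about_z \<theta>"
proof -
  have 0: "A$3$1 = 0" "A$3$2 = 0" "A$1$3 = 0" "A$2$3 = 0"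
    using rotation_matrix_row_col[OF rot, of 3] 33
    by (simp_all add: sum_power2_eq_zero_iff)
  have 1: "(A$1$1)^2 + (A$2$1)^2 = 1" using rotation_matrix_row_col(2)[OF rot, of 1] 0 by simp
  have *: "A$2$2 = A$1$1" using rotation_matrix_minors(1)[OF rot] 0 33 by simp
  have 2: "A$1$1 * A$2$1 + A$1$2 * A$1$1 = 0"
    using arg_cong[OF rotation_matrix_inverse(2)[OF rot], of "\<lambda>M. M$1$2"] 0 *
    by (simp add: matrix_matrix_mult_def transpose_def sum_3 mat_def)
  have 3: "A$1$1 * A$1$1 - A$1$2 * A$2$1 = 1"
    using rotation_matrix_minors(3)[OF rot] 33 * by simp
  \<comment> \<open>Multiplying by 1 in the form of \<open>1\<close> turns the sum into a multiple
    of relation \<open>2\<close> plus a multiple of the difference of \<open>1\<close> and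
    \<open>3\<close>. Both vanish, without a case split on which entry is zero.\<close>
  have "A$1$2 + A$2$1 = (A$1$2 + A$2$1) * ((A$1$1)^2 + (A$2$1)^2)" unfolding 1 by simp
  also have "\<dots> = A$1$1 * (A$1$1 * A$2$1 + A$1$2 * A$1$1)
      + A$2$1 * (((A$1$1)^2 + (A$2$1)^2) - (A$1$1 * A$1$1 - A$1$2 * A$2$1))"
    by (simp add: power2_eq_square algebra_simps)
  also have "\<dots> = 0" unfolding 1 2 3 by simp
  finally have "A$1$2 = - A$2$1" by simp
  moreover have "A$2$2 = A$1$1" by (fact *)
  moreover obtain \<theta> where "A$1$1 = cos \<theta>" "A$2$1 = sin \<theta>" using sincos_total_2pi[OF 1] by metis
  ultimately have "A = rotation_about_z \<theta>"
    using 0 33 by (simp add: rotation_about_z_def vec_eq_iff forall_3)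
  then show thesis by (rule that)
qed

section \<open>The angle of the commutator and the powers of a rotation\<close>

text \<open>The matrix is the product of the turn by \<phi> about the vertical axis and the turn by
  -\<phi> about its image under \<open>transpose A\<close>; the cosine between the two axes is
  \<open>A$3$3\<close>. The squared expression is the real part of the product of the corresponding
  unit quaternions, that is, the cosine of half the resulting angle. The proof expands the trace and
  eliminates all other entries by unit rows and columns and one minor.\<close>

lemma trace_commutator_rotation_about_z:
  fixes A :: "real^3^3"
  assumes rot: "rotation_matrix A"
  fixes \<phi> :: real
  defines "Z \<equiv> rotation_about_z \<phi>"
  shows "trace (Z ** transpose A ** transpose Z ** A)
           = 4 * ((1 + cos \<phi>) / 2 + (1 - cos \<phi>) / 2 * A$3$3)^2 - 1"
proof -
  let ?c = "cos \<phi>" and ?s = "sin \<phi>" and ?a = "A$3$3"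
  have "trace (Z ** transpose A ** transpose Z ** A)
    = ?c^2 * ((A$1$1)^2 + (A$1$2)^2 + (A$2$1)^2 + (A$2$2)^2)
      + 2 * ?s^2 * (A$1$1 * A$2$2 - A$1$2 * A$2$1)
      + ?c * (((A$3$1)^2 + (A$3$2)^2) + ((A$1$3)^2 + (A$2$3)^2)) + ?a^2"
    by (simp add: Z_def rotation_about_z_def trace_def matrix_matrix_mult_def transpose_def sum_3
        power2_eq_square algebra_simps)
  also have "(A$1$1)^2 + (A$1$2)^2 + (A$2$1)^2 + (A$2$2)^2 = 1 + ?a^2"
    using rotation_matrix_row_col(1)[OF rot, of 1] rotation_matrix_row_col(1)[OF rot, of 2]
      rotation_matrix_row_col(2)[OF rot, of 3] by linarith
  also have "A$1$1 * A$2$2 - A$1$2 * A$2$1 = ?a" by (rule rotation_matrix_minors[OF rot])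
  also have "(A$3$1)^2 + (A$3$2)^2 = 1 - ?a^2"
    using rotation_matrix_row_col(1)[OF rot, of 3] by linarith
  also have "(A$1$3)^2 + (A$2$3)^2 = 1 - ?a^2"
    using rotation_matrix_row_col(2)[OF rot, of 3] by linarith
  also have "?s^2 = 1 - ?c^2" by (rule sin_squared_eq)
  finally show ?thesis by (simp add: power2_eq_square field_simps)
qed

text \<open>The middle coefficient of the characteristic polynomial is the sum of the principal
  minors, which for a rotation is again the trace. The trace thus determines the whole
  polynomial.\<close>

lemma rotation_matrix_cayley_hamilton:
  fixes M :: "real^3^3"
  assumes "rotation_matrix M"
  shows "M ** (M ** M) = trace M *\<^sub>R (M ** M) - trace M *\<^sub>R M + mat 1"
    and "trace (M ** M) = (trace M)^2 - 2 * trace M"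
proof -
  let ?m = "M$2$2 * M$3$3 - M$2$3 * M$3$2 + (M$1$1 * M$3$3 - M$1$3 * M$3$1)
    + (M$1$1 * M$2$2 - M$1$2 * M$2$1)"
  have m: "trace M = ?m"
    unfolding rotation_matrix_minors[OF assms] by (simp add: trace_def sum_3)
  have "M ** (M ** M) = trace M *\<^sub>R (M ** M) - ?m *\<^sub>R M + det M *\<^sub>R mat 1"
    by (simp add: vec_eq_iff forall_3 trace_def sum_3 matrix_matrix_mult_def det_3 mat_def algebra_simps)
  then show "M ** (M ** M) = trace M *\<^sub>R (M ** M) - trace M *\<^sub>R M + mat 1"
    using assms unfolding m by (simp add: rotation_matrix_def)
  have "trace (M ** M) = (trace M)^2 - 2 * ?m"
    by (simp add: trace_def sum_3 matrix_matrix_mult_def power2_eq_square algebra_simps)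
  then show "trace (M ** M) = (trace M)^2 - 2 * trace M" unfolding m .
qed

text \<open>The eigenvalues are 1 and exp (\<plusminus> i \<theta>), distinct because
  \<open>sin \<theta> \<noteq> 0\<close>. The spectral decomposition is written with real
  polynomials in \<open>M\<close>, so neither an axis nor complex eigenvectors are chosen:
  \<open>D\<close> is the interpolation polynomial that is 1 at the eigenvalue 1 and 0 at the
  others, with 2 - 2 cos \<theta> as normalising constant. The trace of the k-th power then detects
  whether it is the identity.\<close>

lemma rotation_matrix_pow_eq_mat_1_iff:
  assumes rot: "rotation_matrix M" and tr: "trace M = 1 + 2 * cos \<theta>" and s: "sin \<theta> \<noteq> 0"
  shows "matrix_pow M k = mat 1 \<longleftrightarrow> cos (real k * \<theta>) = 1"
proof -
  let ?c = "cos \<theta>" and ?s = "sin \<theta>"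
  note ch = rotation_matrix_cayley_hamilton[OF rot]
  have c1: "?c \<noteq> 1" using s sin_squared_eq[of \<theta>] by auto
  \<comment> \<open>\<open>D\<close> is the projection onto the rotation axis, \<open>X\<close> the one onto the plane of rotation, and
    \<open>Y\<close> the quarter turn in that plane.\<close>
  define D where "D = (1 / (2 - 2 * ?c)) *\<^sub>R (M ** M - (2 * ?c) *\<^sub>R M + mat 1)"
  define X where "X = mat 1 - D"
  define Y where "Y = (1 / ?s) *\<^sub>R (M - D - ?c *\<^sub>R X)"
  have M2: "M ** M = (2 - 2 * ?c) *\<^sub>R D + (2 * ?c) *\<^sub>R M - mat 1"
    using c1 by (simp add: D_def)
  have MD: "M ** D = D"
    by (simp add: D_def matrix_mult.scaleR_right matrix_mult.add_right matrix_mult.diff_right ch tr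
        algebra_simps)
  have sY: "?s *\<^sub>R Y = M - D - ?c *\<^sub>R X" using s by (simp add: Y_def)
  have MX: "M ** X = ?c *\<^sub>R X + ?s *\<^sub>R Y"
    unfolding sY by (simp add: X_def matrix_mult.diff_right MD)
  have MY: "M ** Y = ?c *\<^sub>R Y - ?s *\<^sub>R X"
  proof -
    have "?s *\<^sub>R (M ** Y) = M ** (?s *\<^sub>R Y)" by (simp add: matrix_mult.scaleR_right)
    also have "\<dots> = M ** M - D - ?c *\<^sub>R (M ** X)"
      unfolding sY by (simp add: matrix_mult.diff_right matrix_mult.scaleR_right MD)
    also have "\<dots> = M ** M - D - ?c *\<^sub>R (?c *\<^sub>R X + ?s *\<^sub>R Y)" by (simp only: MX)
    also have "\<dots> = ?s *\<^sub>R (?c *\<^sub>R Y - ?s *\<^sub>R X)"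
    proof -
      have "?s * ?s = 1 - ?c * ?c" using sin_squared_eq[of \<theta>] by (simp add: power2_eq_square)
      moreover have "?s *\<^sub>R (?c *\<^sub>R Y - ?s *\<^sub>R X) = ?c *\<^sub>R (?s *\<^sub>R Y) - (?s * ?s) *\<^sub>R X"
        by (simp add: algebra_simps)
      ultimately have *: "?s *\<^sub>R (?c *\<^sub>R Y - ?s *\<^sub>R X) = ?c *\<^sub>R (?s *\<^sub>R Y) - (1 - ?c * ?c) *\<^sub>R X"
        by simp
      show ?thesis
        unfolding * unfolding sY M2 unfolding X_def by (simp add: vec_eq_iff algebra_simps)
    qed
    finally show ?thesis using s by simp
  qed
  have pow: "matrix_pow M k = D + cos (real k * \<theta>) *\<^sub>R X + sin (real k * \<theta>) *\<^sub>R Y" for k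
  proof (induction k)
    case 0
    then show ?case by (simp add: matrix_pow_def X_def)
  next
    case (Suc k)
    have "matrix_pow M (Suc k) = M ** matrix_pow M k" by (simp add: matrix_pow_def)
    also have "\<dots> = D + cos (real k * \<theta>) *\<^sub>R (?c *\<^sub>R X + ?s *\<^sub>R Y)
        + sin (real k * \<theta>) *\<^sub>R (?c *\<^sub>R Y - ?s *\<^sub>R X)"
      unfolding Suc by (simp add: matrix_mult.add_right matrix_mult.scaleR_right MD MX MY)
    also have "\<dots> = D + cos (real (Suc k) * \<theta>) *\<^sub>R X + sin (real (Suc k) * \<theta>) *\<^sub>R Y"
      by (simp add: distrib_right cos_add sin_add algebra_simps)
    finally show ?case .
  qed
  have trs: "trace (A + B) = trace A + trace B" "trace (A - B) = trace A - trace B"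
    "trace (x *\<^sub>R A) = x * trace A" "trace (mat 1 :: real^3^3) = 3" for A B :: "real^3^3" and x
    by (simp_all add: trace_def sum_3 mat_def algebra_simps)
  have "trace D = (1 / (2 - 2 * ?c)) *
      ((1 + 2 * ?c)^2 - 2 * (1 + 2 * ?c) - 2 * ?c * (1 + 2 * ?c) + 3)"
    by (simp only: D_def trs ch tr)
  also have "(1 + 2 * ?c)^2 - 2 * (1 + 2 * ?c) - 2 * ?c * (1 + 2 * ?c) + 3 = 2 - 2 * ?c"
    by (simp add: power2_eq_square algebra_simps)
  finally have trD: "trace D = 1" using c1 by simp
  have "?s * trace Y = 0"
    unfolding trs(3)[symmetric] sY by (simp add: trs X_def trD tr)
  then have trpow: "trace (matrix_pow M k) = 1 + 2 * cos (real k * \<theta>)"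
    using s unfolding pow by (simp add: trs X_def trD)
  show ?thesis
  proof
    assume "matrix_pow M k = mat 1"
    then show "cos (real k * \<theta>) = 1" using trpow trs(4) by simp
  next
    assume c: "cos (real k * \<theta>) = 1"
    then have "sin (real k * \<theta>) = 0" using sin_squared_eq[of "real k * \<theta>"] by simp
    with c show "matrix_pow M k = mat 1" unfolding pow by (simp add: X_def)
  qed
qed

section \<open>The rolling equation and uniqueness of its solutions\<close>

lemma angular_velocity_matrix_eq:
  "angular_velocity_matrix r v =
     (1 / r) *\<^sub>R vector [vector [0, 0, v$1], vector [0, 0, v$2], vector [- v$1, - v$2, 0]]"
  by (simp add: angular_velocity_matrix_def matrix_def cross3_def zhat_def embed_plane_def
      vec_eq_iff forall_3 axis_def)

lemma linear_angular_velocity_matrix: "linear (angular_velocity_matrix r)"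
  by (rule linearI) (simp_all add: angular_velocity_matrix_eq vec_eq_iff forall_3 add_divide_distrib diff_divide_distrib)

lemma bounded_linear_angular_velocity_matrix: "bounded_linear (angular_velocity_matrix r)"
  by (simp add: linear_conv_bounded_linear[symmetric] linear_angular_velocity_matrix)

lemma transpose_angular_velocity_matrix:
  "transpose (angular_velocity_matrix r v) = - angular_velocity_matrix r v"
  by (simp add: angular_velocity_matrix_eq vec_eq_iff forall_3 transpose_def)

text \<open>The differential equation is only required off a finite set, which makes solutions easy to
  glue; for piecewise \<open>C\<^sup>1\<^sup>,\<^sup>\<delta>\<close> paths this is equivalent to \<^const>\<open>rolling_orientation\<close>.\<close>

definition weak_rolling :: "(real \<Rightarrow> real^2) \<Rightarrow> real \<Rightarrow> (real \<Rightarrow> real^3^3) \<Rightarrow> bool" where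
  "weak_rolling \<gamma> r Q \<longleftrightarrow>
     continuous_on {0..1} Q \<and> Q 0 = mat 1 \<and>
     (\<exists>S. finite S \<and> (\<forall>t\<in>{0<..<1} - S. \<exists>v. (\<gamma> has_vector_derivative v) (at t) \<and>
        (Q has_vector_derivative angular_velocity_matrix r v ** Q t) (at t)))"

lemma continuous_const_if_zero_derivative:
  fixes f :: "real \<Rightarrow> 'a::banach"
  assumes "finite S" "continuous_on {a..b} f" "t \<in> {a..b}"
    and "\<And>t. t \<in> {a<..<b} - S \<Longrightarrow> (f has_vector_derivative 0) (at t)"
  shows "f t = f a"
proof -
  have "((\<lambda>x. 0) has_integral (f t - f a)) {a..t}"
    by (rule fundamental_theorem_of_calculus_interior_strong[OF assms(1)])
       (use assms in \<open>auto intro: continuous_on_subset\<close>)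
  then show ?thesis using has_integral_unique[OF has_integral_0] by (metis eq_iff_diff_eq_0)
qed

text \<open>The angular velocity matrix is skew-symmetric, so transposing the equation of
  \<open>Q\<close> only flips a sign, and it scales with the inverse radius, so the two terms of the
  product rule combine.\<close>

lemma weak_rolling_transpose_mult:
  assumes "weak_rolling \<gamma> r Q" "weak_rolling \<gamma> s R"
  obtains S where "finite S"
    "\<And>t. t \<in> {0<..<1} - S \<Longrightarrow> \<exists>v. (\<gamma> has_vector_derivative v) (at t) \<and>
       ((\<lambda>t. transpose (Q t) ** R t) has_vector_derivative
          (1 / s - 1 / r) *\<^sub>R (transpose (Q t) ** (angular_velocity_matrix 1 v ** R t))) (at t)"
proof -
  obtain S where S: "finite S" "\<And>t. t \<in> {0<..<1} - S \<Longrightarrow> \<exists>v. (\<gamma> has_vector_derivative v) (at t) \<and>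
        (Q has_vector_derivative angular_velocity_matrix r v ** Q t) (at t)"
    using assms(1) unfolding weak_rolling_def by metis
  obtain T where T: "finite T" "\<And>t. t \<in> {0<..<1} - T \<Longrightarrow> \<exists>v. (\<gamma> has_vector_derivative v) (at t) \<and>
        (R has_vector_derivative angular_velocity_matrix s v ** R t) (at t)"
    using assms(2) unfolding weak_rolling_def by metis
  show thesis
  proof
    show "finite (S \<union> T)" using S T by simp
    fix t :: real assume t: "t \<in> {0<..<1} - (S \<union> T)"
    obtain v w where v: "(\<gamma> has_vector_derivative v) (at t)"
        "(Q has_vector_derivative angular_velocity_matrix r v ** Q t) (at t)"
      and w: "(\<gamma> has_vector_derivative w) (at t)"
        "(R has_vector_derivative angular_velocity_matrix s w ** R t) (at t)"
      using S(2)[of t] T(2)[of t] t by blast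
    have "w = v" using v w vector_derivative_unique_at by blast
    have av: "angular_velocity_matrix x v = (1 / x) *\<^sub>R angular_velocity_matrix 1 v" for x
      by (simp add: angular_velocity_matrix_eq)
    have "((\<lambda>t. transpose (Q t) ** R t) has_vector_derivative
          transpose (Q t) ** (angular_velocity_matrix s v ** R t)
          + transpose (angular_velocity_matrix r v ** Q t) ** R t) (at t)"
      using w v unfolding \<open>w = v\<close>
      by (intro matrix_mult.has_vector_derivative
          bounded_linear.has_vector_derivative[OF bounded_linear_transpose])
    also have "transpose (Q t) ** (angular_velocity_matrix s v ** R t)
          + transpose (angular_velocity_matrix r v ** Q t) ** R t
        = (1 / s - 1 / r) *\<^sub>R (transpose (Q t) ** (angular_velocity_matrix 1 v ** R t))"
      unfolding av[of s] av[of r] matrix_transpose_mul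
        linear_scale[OF bounded_linear.linear[OF bounded_linear_transpose]] transpose_angular_velocity_matrix
      by (simp only: matrix_mult.scaleR_left matrix_mult.scaleR_right matrix_mult.minus_left
          matrix_mult.minus_right matrix_mul_assoc[symmetric] scaleR_minus_right
          scaleR_left_diff_distrib add_uminus_conv_diff)
    finally show "\<exists>v. (\<gamma> has_vector_derivative v) (at t) \<and>
       ((\<lambda>t. transpose (Q t) ** R t) has_vector_derivative
          (1 / s - 1 / r) *\<^sub>R (transpose (Q t) ** (angular_velocity_matrix 1 v ** R t))) (at t)"
      using v by blast
  qed
qed

lemma weak_rolling_transpose_mult_const:
  assumes Q: "weak_rolling \<gamma> r Q" and R: "weak_rolling \<gamma> r R" and t: "t \<in> {0..1}"
  shows "transpose (Q t) ** R t = mat 1"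
proof -
  obtain S where S: "finite S" "\<And>t. t \<in> {0<..<1} - S \<Longrightarrow>
      ((\<lambda>t. transpose (Q t) ** R t) has_vector_derivative 0) (at t)"
    by (rule weak_rolling_transpose_mult[OF Q R]) fastforce
  have "transpose (Q t) ** R t = transpose (Q 0) ** R 0"
    by (rule continuous_const_if_zero_derivative[OF S(1) _ t S(2)])
       (use Q R in \<open>auto simp: weak_rolling_def intro!: matrix_mult.continuous_on
          bounded_linear.continuous_on[OF bounded_linear_transpose]\<close>)
  also have "\<dots> = mat 1" using Q R by (simp add: weak_rolling_def)
  finally show ?thesis .
qed

text \<open>Orthogonality comes from comparing the solution with itself. The determinant is then 1
  or -1 everywhere and starts at 1; reaching -1 would force a zero in between by continuity.\<close>

lemma weak_rolling_rotation_matrix: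
  assumes Q: "weak_rolling \<gamma> r Q" and t: "t \<in> {0..1}"
  shows "rotation_matrix (Q t)"
proof -
  have orth: "orthogonal_matrix (Q u)" if "u \<in> {0..1}" for u
    using weak_rolling_transpose_mult_const[OF Q Q that] by (simp add: orthogonal_matrix)
  have c: "continuous_on {0..1} Q" using Q by (simp add: weak_rolling_def)
  have "continuous_on {0..t} (\<lambda>u. det (Q u))"
    unfolding det_3 by (intro continuous_intros continuous_on_component continuous_on_subset[OF c])
      (use t in auto)
  moreover have "det (Q 0) = 1" using Q by (simp add: weak_rolling_def)
  moreover have "det (Q u) = 1 \<or> det (Q u) = -1" if "u \<in> {0..t}" for u
    using det_orthogonal_matrix[OF orth, of u] that t by auto
  ultimately have "det (Q t) \<noteq> -1"
    using IVT2'[of "\<lambda>u. det (Q u)" t 0 0] t by force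
  then have "det (Q t) = 1" using det_orthogonal_matrix[OF orth[OF t]] by simp
  then show ?thesis using orth[OF t] by (simp add: rotation_matrix_def)
qed

lemma weak_rolling_unique:
  assumes Q: "weak_rolling \<gamma> r Q" and R: "weak_rolling \<gamma> r R" and t: "t \<in> {0..1}"
  shows "Q t = R t"
proof -
  have "Q t = Q t ** (transpose (Q t) ** R t)"
    by (simp add: weak_rolling_transpose_mult_const[OF Q R t])
  also have "\<dots> = R t"
    unfolding matrix_mul_assoc rotation_matrix_inverse(2)[OF weak_rolling_rotation_matrix[OF Q t]]
    by simp
  finally show ?thesis .
qed

section \<open>Smooth pieces and existence of the orientation\<close>

lemma partition_bounds:
  fixes p :: "nat \<Rightarrow> real"
  assumes "\<And>i. i < m \<Longrightarrow> p i < p (Suc i)" "i \<le> m"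
  shows "p 0 \<le> p i" "p i \<le> p m"
proof -
  have "p i \<le> p j" if "i \<le> j" "j \<le> m" for i j
    using that(1,2)
  proof (induction rule: dec_induct)
    case (step n)
    then show ?case using assms(1)[of n] by simp
  qed simp
  then show "p 0 \<le> p i" "p i \<le> p m" using assms(2) by auto
qed

lemma partition_cases:
  fixes p :: "nat \<Rightarrow> real"
  assumes "t \<in> {p 0<..<p m} - p ` {..m}"
  obtains i where "i < m" "t \<in> {p i<..<p (Suc i)}"
proof -
  have "\<exists>i<m. t \<in> {p i<..<p (Suc i)}"
    using assms
  proof (induction m)
    case (Suc m)
    show ?case
    proof (cases "t < p m")
      case True
      then show ?thesis using Suc by (auto simp: less_Suc_eq atMost_Suc)
    next
      case False
      then have "p m < t" using Suc.prems by (auto simp: atMost_Suc)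
      then show ?thesis using Suc.prems by auto
    qed
  qed simp
  then show thesis using that by blast
qed

text \<open>A Hoelder bound with positive exponent tends to 0. The resulting continuity makes the
  coefficient of the rolling equation continuous on each piece, as the existence lemma
  demands.\<close>

lemma holder_C1_on_derivative:
  assumes "holder_C1_on \<delta> S \<gamma>" "0 < \<delta>"
  obtains \<gamma>' where "\<And>t. t \<in> S \<Longrightarrow> (\<gamma> has_vector_derivative \<gamma>' t) (at t within S)"
    "continuous_on S \<gamma>'"
proof -
  obtain \<gamma>' C where d: "\<And>t. t \<in> S \<Longrightarrow> (\<gamma> has_vector_derivative \<gamma>' t) (at t within S)"
    and C: "\<And>s t. s \<in> S \<Longrightarrow> t \<in> S \<Longrightarrow> norm (\<gamma>' s - \<gamma>' t) \<le> C * \<bar>s - t\<bar> powr \<delta>"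
    using assms unfolding holder_C1_on_def by blast
  have "(\<gamma>' \<longlongrightarrow> \<gamma>' s) (at s within S)" if "s \<in> S" for s
  proof -
    have "((\<lambda>t. \<bar>t - s\<bar> powr \<delta>) \<longlongrightarrow> 0) (at s within S)"
    proof (rule tendsto_zero_powrI)
      show "((\<lambda>t. \<bar>t - s\<bar>) \<longlongrightarrow> 0) (at s within S)"
        by (rule tendsto_eq_intros | simp)+
    qed (use assms in auto)
    then have "((\<lambda>t. C * \<bar>t - s\<bar> powr \<delta>) \<longlongrightarrow> 0) (at s within S)"
      by (auto intro: tendsto_mult_right_zero)
    moreover have "eventually (\<lambda>t. norm (\<gamma>' t - \<gamma>' s) \<le> C * \<bar>t - s\<bar> powr \<delta>) (at s within S)"
      using C that by (auto simp: eventually_at_filter intro: always_eventually)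
    ultimately have "((\<lambda>t. \<gamma>' t - \<gamma>' s) \<longlongrightarrow> 0) (at s within S)"
      by (rule Lim_null_comparison[rotated])
    then show ?thesis by (simp add: LIM_zero_iff)
  qed
  then show thesis using that d by (auto simp: continuous_on_def)
qed

lemma smooth_piece_derivative:
  assumes "smooth_piece \<gamma> a b"
  shows "\<And>t. t \<in> {a..b} \<Longrightarrow>
      (\<gamma> has_vector_derivative vector_derivative \<gamma> (at t within {a..b})) (at t within {a..b})"
    and "continuous_on {a..b} (\<lambda>t. vector_derivative \<gamma> (at t within {a..b}))"
proof -
  obtain \<delta> where "0 < \<delta>" "holder_C1_on \<delta> {a..b} \<gamma>" and ab: "a < b"
    using assms unfolding smooth_piece_def by blast
  then obtain \<gamma>' where g: "\<And>t. t \<in> {a..b} \<Longrightarrow> (\<gamma> has_vector_derivative \<gamma>' t) (at t within {a..b})"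
    "continuous_on {a..b} \<gamma>'"
    using holder_C1_on_derivative by blast
  have eq: "vector_derivative \<gamma> (at t within {a..b}) = \<gamma>' t" if "t \<in> {a..b}" for t
    using vector_derivative_within_closed_interval[OF ab that g(1)[OF that]] .
  show "\<And>t. t \<in> {a..b} \<Longrightarrow>
      (\<gamma> has_vector_derivative vector_derivative \<gamma> (at t within {a..b})) (at t within {a..b})"
    using g(1) by (simp only: eq)
  show "continuous_on {a..b} (\<lambda>t. vector_derivative \<gamma> (at t within {a..b}))"
    using g(2) by (subst continuous_on_cong[OF refl eq])
qed

lemma piecewise_holder_path_partition:
  assumes "piecewise_holder_path \<gamma>"
  shows "\<exists>p m. p 0 = 0 \<and> p m = 1 \<and> (\<forall>i<m. p i < p (Suc i)) \<and>
    (\<forall>i<m. smooth_piece \<gamma> (p i) (p (Suc i)))"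
proof -
  obtain \<delta> m p where *: "0 < \<delta>" "\<delta> \<le> 1" "p 0 = 0" "p m = 1"
    and p: "\<And>i. i < m \<Longrightarrow> p i < p (Suc i) \<and> holder_C1_on \<delta> {p i..p (Suc i)} \<gamma>"
    using assms unfolding piecewise_holder_path_def by blast
  have "smooth_piece \<gamma> (p i) (p (Suc i))" if "i < m" for i
  proof -
    have "p i < p (Suc i)" "holder_C1_on \<delta> {p i..p (Suc i)} \<gamma>" using p[OF that] by auto
    moreover have "0 \<le> p i" using partition_bounds(1)[of m p i] p that *(3) by simp
    moreover have "p (Suc i) \<le> 1" using partition_bounds(2)[of m p "Suc i"] p that *(4) by simp
    ultimately show ?thesis using *(1,2) unfolding smooth_piece_def by blast
  qed
  then show ?thesis using *(3,4) p by (intro exI[of _ p] exI[of _ m]) simp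
qed

lemma rolling_orientation_imp_weak_rolling:
  assumes P: "piecewise_holder_path \<gamma>" and Q: "rolling_orientation \<gamma> r Q"
  shows "weak_rolling \<gamma> r Q"
proof -
  obtain p m where p: "p 0 = 0" "p m = 1" "\<forall>i<m. p i < p (Suc i)"
    "\<forall>i<m. smooth_piece \<gamma> (p i) (p (Suc i))"
    using piecewise_holder_path_partition[OF P] by (elim exE conjE)
  have Q': "continuous_on {0..1} Q" "Q 0 = mat 1"
    and ode: "\<forall>a b. smooth_piece \<gamma> a b \<longrightarrow> (\<forall>t\<in>{a..b}. (Q has_vector_derivative
       angular_velocity_matrix r (vector_derivative \<gamma> (at t within {a..b})) ** Q t)
         (at t within {a..b}))"
    using Q unfolding rolling_orientation_def by - (elim conjE, assumption)+
  have "\<exists>v. (\<gamma> has_vector_derivative v) (at t) \<and>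
        (Q has_vector_derivative angular_velocity_matrix r v ** Q t) (at t)"
    if t: "t \<in> {0<..<1} - p ` {..m}" for t
  proof -
    obtain i where i: "i < m" "t \<in> {p i<..<p (Suc i)}"
      by (rule partition_cases[of t p m]) (use t p(1,2) in simp, blast)
    then have at: "at t within {p i..p (Suc i)} = at t" and t': "t \<in> {p i..p (Suc i)}"
      by (simp_all add: at_within_Icc_at)
    have "(\<gamma> has_vector_derivative vector_derivative \<gamma> (at t)) (at t)"
      using smooth_piece_derivative(1)[OF p(4)[rule_format, OF i(1)] t'] unfolding at .
    moreover have "(Q has_vector_derivative
        angular_velocity_matrix r (vector_derivative \<gamma> (at t)) ** Q t) (at t)"
      using ode[rule_format, OF p(4)[rule_format, OF i(1)] t'] unfolding at .
    ultimately show ?thesis by blast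
  qed
  then have "\<exists>S. finite S \<and> (\<forall>t\<in>{0<..<1} - S. \<exists>v. (\<gamma> has_vector_derivative v) (at t) \<and>
        (Q has_vector_derivative angular_velocity_matrix r v ** Q t) (at t))"
    by (intro exI[of _ "p ` {..m}"] conjI ballI) simp_all
  then show ?thesis
    using Q' unfolding weak_rolling_def by (intro conjI)
qed

text \<open>A smooth piece may contain exceptional points, and its ends need one-sided derivatives.
  The fundamental theorem ignores a finite set, so on the piece \<open>Q\<close> is an integral of
  the right-hand side; that integrand is continuous there, so the derivative exists at every
  point.\<close>

lemma weak_rolling_imp_rolling_orientation:
  assumes Q: "weak_rolling \<gamma> r Q"
  shows "rolling_orientation \<gamma> r Q"
  unfolding rolling_orientation_def
proof (intro conjI allI impI ballI)
  show "continuous_on {0..1} Q" "Q 0 = mat 1" using Q by (simp_all add: weak_rolling_def)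
  show "rotation_matrix (Q t)" if "t \<in> {0..1}" for t
    using weak_rolling_rotation_matrix[OF Q that] .
  fix a b t assume sp: "smooth_piece \<gamma> a b" and t: "t \<in> {a..b}"
  let ?v = "\<lambda>t. vector_derivative \<gamma> (at t within {a..b})"
  let ?g = "\<lambda>t. angular_velocity_matrix r (?v t) ** Q t"
  have ab: "0 \<le> a" "b \<le> 1" "a < b" using sp by (auto simp: smooth_piece_def)
  have cQ: "continuous_on {a..b} Q"
    by (rule continuous_on_subset[of "{0..1}"]) (use Q ab in \<open>auto simp: weak_rolling_def\<close>)
  obtain S where S: "finite S" "\<And>t. t \<in> {0<..<1} - S \<Longrightarrow> \<exists>v. (\<gamma> has_vector_derivative v) (at t) \<and>
        (Q has_vector_derivative angular_velocity_matrix r v ** Q t) (at t)"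
    using Q unfolding weak_rolling_def by blast
  have d: "(Q has_vector_derivative ?g x) (at x)" if x: "x \<in> {a<..<b} - S" for x
  proof -
    obtain v where v: "(\<gamma> has_vector_derivative v) (at x)"
        "(Q has_vector_derivative angular_velocity_matrix r v ** Q x) (at x)"
      using S(2)[of x] x ab by auto
    have "at x within {a..b} = at x" using x by (simp add: at_within_Icc_at)
    then have "?v x = v" using v(1) by (simp add: vector_derivative_at)
    then show ?thesis using v(2) by simp
  qed
  have eq: "Q x = Q a + integral {a..x} ?g" if x: "x \<in> {a..b}" for x
  proof -
    have "(?g has_integral (Q x - Q a)) {a..x}"
      by (rule fundamental_theorem_of_calculus_interior_strong[OF S(1)])
         (use x d cQ in \<open>auto intro: continuous_on_subset\<close>)
    then show ?thesis by (simp add: integral_unique)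
  qed
  have "continuous_on {a..b} ?g"
    using smooth_piece_derivative(2)[OF sp] cQ
    by (intro matrix_mult.continuous_on
        bounded_linear.continuous_on[OF bounded_linear_angular_velocity_matrix])
  then have "((\<lambda>x. Q a + integral {a..x} ?g) has_vector_derivative 0 + ?g t) (at t within {a..b})"
    by (intro has_vector_derivative_add integral_has_vector_derivative t
        has_vector_derivative_const)
  then show "(Q has_vector_derivative ?g t) (at t within {a..b})"
    using has_vector_derivative_transform[OF t eq] by simp
qed

lemma weak_rolling_exists:
  assumes P: "piecewise_holder_path \<gamma>"
  obtains Q where "weak_rolling \<gamma> r Q"
proof -
  obtain p m where p: "p 0 = 0" "p m = 1" "\<forall>i<m. p i < p (Suc i)"
    "\<forall>i<m. smooth_piece \<gamma> (p i) (p (Suc i))"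
    using piecewise_holder_path_partition[OF P] by (elim exE conjE)
  let ?ode = "\<lambda>Q t. \<exists>v. (\<gamma> has_vector_derivative v) (at t) \<and>
        (Q has_vector_derivative angular_velocity_matrix r v ** Q t) (at t)"
  \<comment> \<open>The excluded set is the whole partition at every stage, so the junction
    \<open>p k\<close> is already exempt when the next piece is attached; only continuity has to be
    checked there.\<close>
  have "\<exists>Q. continuous_on {0..p k} Q \<and> Q 0 = mat 1 \<and> (\<forall>t\<in>{0<..<p k} - p ` {..m}. ?ode Q t)"
    if "k \<le> m" for k
    using that
  proof (induction k)
    case 0
    then show ?case using p by (intro exI[of _ "\<lambda>t. mat 1"]) auto
  next
    case (Suc k)
    then obtain Q where Q: "continuous_on {0..p k} Q" "Q 0 = mat 1"
      "\<And>t. t \<in> {0<..<p k} - p ` {..m} \<Longrightarrow> ?ode Q t"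
      by auto
    let ?I = "{p k..p (Suc k)}"
    have k: "k < m" "0 \<le> p k" "p k < p (Suc k)"
      using Suc.prems partition_bounds(1)[of m p k] p(1,3) by auto
    note sp = smooth_piece_derivative[OF p(4)[rule_format, OF k(1)]]
    have "continuous_on ?I (\<lambda>t. angular_velocity_matrix r (vector_derivative \<gamma> (at t within ?I)))"
      using sp(2) by (rule bounded_linear.continuous_on[OF bounded_linear_angular_velocity_matrix])
    then obtain R where R: "R (p k) = Q (p k)" "\<And>t. t \<in> ?I \<Longrightarrow> (R has_vector_derivative
        angular_velocity_matrix r (vector_derivative \<gamma> (at t within ?I)) ** R t) (at t within ?I)"
      by (rule linear_ode_exists[OF bounded_bilinear_matrix_matrix_mult, of _ _ _ "Q (p k)"]) blast
    define N where "N t = (if t \<le> p k then Q t else R t)" for t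
    have "continuous_on {0..p (Suc k)} N"
      unfolding N_def
    proof (rule continuous_on_cases_le)
      show "continuous_on {t \<in> {0..p (Suc k)}. t \<le> p k} Q"
        using Q(1) by (rule continuous_on_subset) auto
      have "continuous_on ?I R"
        using has_vector_derivative_continuous[OF R(2)]
        by (simp add: continuous_on_eq_continuous_within)
      then show "continuous_on {t \<in> {0..p (Suc k)}. p k \<le> t} R"
        by (rule continuous_on_subset) auto
    qed (use R(1) in auto)
    moreover have "N 0 = mat 1" using k Q(2) by (simp add: N_def)
    moreover have "?ode N t" if t: "t \<in> {0<..<p (Suc k)} - p ` {..m}" for t
    proof -
      have "t \<noteq> p k" using t k(1) by auto
      then consider "t < p k" | "p k < t" by linarith
      then show ?thesis
      proof cases
        case 1
        then obtain v where v: "(\<gamma> has_vector_derivative v) (at t)"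
          "(Q has_vector_derivative angular_velocity_matrix r v ** Q t) (at t)"
          using Q(3)[of t] t by auto
        have "(N has_vector_derivative angular_velocity_matrix r v ** Q t) (at t)"
          by (rule has_vector_derivative_transform_within_open[OF v(2), of "{..<p k}"])
             (use 1 in \<open>auto simp: N_def\<close>)
        then show ?thesis using v(1) 1 by (auto simp: N_def)
      next
        case 2
        then have "at t within ?I = at t" using t by (simp add: at_within_Icc_at)
        then obtain v where v: "(\<gamma> has_vector_derivative v) (at t)"
          "(R has_vector_derivative angular_velocity_matrix r v ** R t) (at t)"
          using sp(1)[of t] R(2)[of t] t 2 by auto
        have "(N has_vector_derivative angular_velocity_matrix r v ** R t) (at t)"
          by (rule has_vector_derivative_transform_within_open[OF v(2), of "{p k<..}"])
             (use 2 in \<open>auto simp: N_def\<close>)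
        then show ?thesis using v(1) 2 by (auto simp: N_def)
      qed
    qed
    ultimately show ?case by blast
  qed
  from this[of m] obtain Q where "continuous_on {0..1} Q" "Q 0 = mat 1"
    "\<forall>t\<in>{0<..<1} - p ` {..m}. ?ode Q t"
    using p by auto
  then have "weak_rolling \<gamma> r Q" unfolding weak_rolling_def by blast
  then show thesis by (rule that)
qed

text \<open>Existence comes from the weak solution at hand, uniqueness from weakening every
  competitor. From here on any weak solution may be used to compute the rotation.\<close>

lemma rolling_rotation_eq:
  assumes P: "piecewise_holder_path \<gamma>" and Q: "weak_rolling \<gamma> r Q"
  shows "rolling_rotation \<gamma> r = Q 1"
  unfolding rolling_rotation_def
proof (rule the_equality)
  show "\<exists>R. rolling_orientation \<gamma> r R \<and> Q 1 = R 1"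
    using weak_rolling_imp_rolling_orientation[OF Q] by blast
  show "A = Q 1" if "\<exists>R. rolling_orientation \<gamma> r R \<and> A = R 1" for A
    using that rolling_orientation_imp_weak_rolling[OF P] weak_rolling_unique[OF _ Q, of _ 1] by auto
qed

lemma rotation_matrix_rolling_rotation:
  assumes "piecewise_holder_path \<gamma>"
  shows "rotation_matrix (rolling_rotation \<gamma> r)"
  using weak_rolling_exists[OF assms, of r] rolling_rotation_eq[OF assms]
    weak_rolling_rotation_matrix[of \<gamma> r _ 1] by (metis atLeastAtMost_iff order_refl zero_le_one)

section \<open>The path there and rotated back\<close>

text \<open>One statement serves both halves of the new path: slope 2 with the identity for the way
  out, slope -2 with the plane rotation for the way back.\<close>

lemma holder_C1_on_affine:
  assumes h: "holder_C1_on \<delta> S \<gamma>" and L: "bounded_linear L"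
    and S: "\<And>t. t \<in> T \<Longrightarrow> a * t + b \<in> S"
    and g: "\<And>t. t \<in> T \<Longrightarrow> g t = c + L (\<gamma> (a * t + b))"
  shows "holder_C1_on \<delta> T g"
proof -
  obtain \<gamma>' C where d: "\<And>t. t \<in> S \<Longrightarrow> (\<gamma> has_vector_derivative \<gamma>' t) (at t within S)"
    and C: "\<And>s t. s \<in> S \<Longrightarrow> t \<in> S \<Longrightarrow> norm (\<gamma>' s - \<gamma>' t) \<le> C * \<bar>s - t\<bar> powr \<delta>"
    using h unfolding holder_C1_on_def by blast
  interpret L: bounded_linear L by (rule L)
  obtain K where K: "0 < K" "\<And>x. norm (L x) \<le> norm x * K" using L.pos_bounded by blast
  let ?g' = "\<lambda>t. L (a *\<^sub>R \<gamma>' (a * t + b))"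
  have "(g has_vector_derivative ?g' t) (at t within T)" if t: "t \<in> T" for t
  proof -
    have lin: "((\<lambda>t. a * t + b) has_vector_derivative a) (at t within T)"
      by (auto intro!: derivative_eq_intros simp: has_real_derivative_iff_has_vector_derivative[symmetric])
    have "(\<gamma> has_vector_derivative \<gamma>' (a * t + b)) (at (a * t + b) within (\<lambda>t. a * t + b) ` T)"
      using d[OF S[OF t]] by (rule has_vector_derivative_within_subset) (use S in auto)
    from vector_diff_chain_within[OF lin this]
    have "((\<lambda>t. c + L (\<gamma> (a * t + b))) has_vector_derivative 0 + ?g' t) (at t within T)"
      by (intro has_vector_derivative_add has_vector_derivative_const L.has_vector_derivative)
         (simp add: o_def)
    then show ?thesis using has_vector_derivative_transform[OF t g] by simp
  qed
  \<comment> \<open>The factor \<open>\<bar>a\<bar>\<close> is the chain rule,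
    \<open>\<bar>a\<bar> powr \<delta>\<close> the stretching of distances in the parameter, and
    \<open>K\<close> bounds \<open>L\<close>.\<close>
  moreover have "norm (?g' s - ?g' t) \<le> (\<bar>a\<bar> * C * \<bar>a\<bar> powr \<delta> * K) * \<bar>s - t\<bar> powr \<delta>"
    if "s \<in> T" "t \<in> T" for s t
  proof -
    have "norm (?g' s - ?g' t) = norm (L (a *\<^sub>R (\<gamma>' (a * s + b) - \<gamma>' (a * t + b))))"
      by (simp add: L.diff L.scaleR scaleR_diff_right)
    also have "\<dots> \<le> \<bar>a\<bar> * norm (\<gamma>' (a * s + b) - \<gamma>' (a * t + b)) * K"
      using K(2)[of "a *\<^sub>R (\<gamma>' (a * s + b) - \<gamma>' (a * t + b))"] by simp
    also have "\<dots> \<le> \<bar>a\<bar> * (C * \<bar>(a * s + b) - (a * t + b)\<bar> powr \<delta>) * K"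
      using C[OF S S, OF that] K(1) by (intro mult_right_mono mult_left_mono) auto
    also have "\<bar>(a * s + b) - (a * t + b)\<bar> = \<bar>a\<bar> * \<bar>s - t\<bar>"
      by (simp add: abs_mult[symmetric] right_diff_distrib)
    finally show ?thesis by (simp add: powr_mult mult_ac)
  qed
  ultimately show ?thesis
    unfolding holder_C1_on_def
    by (intro exI[of _ ?g'] conjI ballI exI[of _ "\<bar>a\<bar> * C * \<bar>a\<bar> powr \<delta> * K"])
qed

text \<open>The linear part of \<open>rotate_plane_about\<close>, and the upper left block of
  \<open>rotation_about_z\<close>.\<close>

definition plane_rotation :: "real \<Rightarrow> real^2^2" where
  "plane_rotation \<theta> = vector [vector [cos \<theta>, - sin \<theta>], vector [sin \<theta>, cos \<theta>]]"

lemma there_and_rotated_back_left: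
  "t \<le> 1 / 2 \<Longrightarrow> there_and_rotated_back \<theta> W t = W (2 * t)"
  by (simp add: there_and_rotated_back_def joinpaths_def)

text \<open>The time 1/2 belongs to the first branch of the join, but the formula of the second is
  valid there too, because the centre of rotation is the end point of \<open>W\<close>. So closed
  pieces can be treated.\<close>

lemma there_and_rotated_back_right:
  assumes "1 / 2 \<le> t"
  shows "there_and_rotated_back \<theta> W t
    = (W 1 - plane_rotation \<theta> *v W 1) + plane_rotation \<theta> *v W (2 - 2 * t)"
proof (cases "t = 1 / 2")
  case True
  show ?thesis unfolding True by (simp add: there_and_rotated_back_left)
next
  case False
  then show ?thesis using assms
    by (simp add: there_and_rotated_back_def joinpaths_def reversepath_def rotate_plane_about_def
        plane_rotation_def pathfinish_def matrix_vector_mult_diff_distrib)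
qed

lemma piecewise_holder_path_there_and_rotated_back:
  assumes "piecewise_holder_path W"
  shows "piecewise_holder_path (there_and_rotated_back \<theta> W)"
proof -
  let ?P = "there_and_rotated_back \<theta> W"
  obtain \<delta> m p where pW: "path W" and \<delta>: "0 < \<delta>" "\<delta> \<le> 1" and p01: "p 0 = 0" "p m = 1"
    and ph: "\<forall>i<m. p i < p (Suc i) \<and> holder_C1_on \<delta> {p i..p (Suc i)} W"
    using assms unfolding piecewise_holder_path_def by (elim conjE exE)
  have p: "p i < p (Suc i)" and h: "holder_C1_on \<delta> {p i..p (Suc i)} W" if "i < m" for i
    using ph that by simp_all
  have "continuous_on UNIV (rotate_plane_about (pathfinish W) \<theta>)"
    unfolding rotate_plane_about_def
    by (intro continuous_intros bounded_linear.continuous_on[OF matrix_vector_mul_bounded_linear])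
  then have "path (rotate_plane_about (pathfinish W) \<theta> \<circ> W)"
    using pW by (intro path_continuous_image) (auto intro: continuous_on_subset)
  then have path: "path ?P"
    using pW unfolding there_and_rotated_back_def
    by (intro path_join_imp) (simp_all add: rotate_plane_about_def pathfinish_def)
  \<comment> \<open>The partition of \<open>W\<close> at half scale, followed by its mirror image
    about 1/2; both formulas give 1/2 at \<open>i = m\<close>.\<close>
  define q where "q i = (if i \<le> m then p i / 2 else 1 - p (2 * m - i) / 2)" for i
  have m: "0 < m" using p01 by (cases m) auto
  have "q 0 = 0" "q (2 * m) = 1" using m p01 by (auto simp: q_def)
  moreover have "q i < q (Suc i) \<and> holder_C1_on \<delta> {q i..q (Suc i)} ?P" if i: "i < 2 * m" for i
  proof (cases "i < m")
    case True
    then have q: "q i = p i / 2" "q (Suc i) = p (Suc i) / 2" by (auto simp: q_def)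
    have "p (Suc i) \<le> 1" using partition_bounds(2)[of m p "Suc i"] p p01 True by simp
    then have "holder_C1_on \<delta> {q i..q (Suc i)} ?P"
      unfolding q
      by (intro holder_C1_on_affine[OF h[OF True] bounded_linear_ident, of _ 2 0 _ 0])
         (auto simp: there_and_rotated_back_left)
    then show ?thesis using p[OF True] unfolding q by simp
  next
    case False
    \<comment> \<open>The way back runs through the pieces of \<open>W\<close> in reverse order;
      piece \<open>i\<close> of the new path comes from piece \<open>l\<close>.\<close>
    define l where "l = 2 * m - Suc i"
    have l: "l < m" using False i by (auto simp: l_def)
    have q: "q i = 1 - p (Suc l) / 2" "q (Suc i) = 1 - p l / 2"
      using False i p01 by (auto simp: q_def l_def Suc_diff_Suc)
    have "p (Suc l) \<le> 1" using partition_bounds(2)[of m p "Suc l"] p p01 l by simp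
    then have "holder_C1_on \<delta> {q i..q (Suc i)} ?P"
      unfolding q
      by (intro holder_C1_on_affine[OF h[OF l] matrix_vector_mul_bounded_linear[of "plane_rotation \<theta>"],
            of _ "-2" 2 _ "W 1 - plane_rotation \<theta> *v W 1"])
         (auto simp: there_and_rotated_back_right algebra_simps)
    then show ?thesis using p[OF l] unfolding q by simp
  qed
  ultimately show ?thesis
    unfolding piecewise_holder_path_def using path \<delta>
    by (intro conjI exI[of _ \<delta>] exI[of _ "2 * m"] exI[of _ q]) simp_all
qed

text \<open>Turning the velocity about the vertical turns the angular velocity with it, so the two
  matrices are conjugate. Writing the conjugation without an inverse suits the products
  below.\<close>

lemma angular_velocity_matrix_rotate:
  "angular_velocity_matrix r (plane_rotation \<theta> *v v) ** rotation_about_z \<theta>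
     = rotation_about_z \<theta> ** angular_velocity_matrix r v"
proof -
  have *: "cos \<theta> * (cos \<theta> * x) = x - sin \<theta> * (sin \<theta> * x)" for x
    using sin_cos_squared_add[of \<theta>] by algebra
  show ?thesis
    unfolding angular_velocity_matrix_eq matrix_mult.scaleR_left matrix_mult.scaleR_right
    by (rule arg_cong[of _ _ "scaleR (1 / r)"])
       (simp add: vec_eq_iff forall_3 matrix_matrix_mult_def sum_3 sum_2
         matrix_vector_mult_def plane_rotation_def rotation_about_z_def algebra_simps *)
qed

text \<open>Running \<open>Q\<close> backwards solves the equation for reversed \<open>W\<close>,
  and left multiplication by \<open>Z\<close> passes to the rotated copy. Right multiplication by a
  constant preserves a linear equation; \<open>K\<close> is the constant for which both halves meet
  in \<open>Q 1\<close> at time 1/2.\<close>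

lemma weak_rolling_there_and_rotated_back:
  assumes Q: "weak_rolling W r Q"
  fixes \<theta> :: real
  defines "Z \<equiv> rotation_about_z \<theta>"
  defines "K \<equiv> transpose (Q 1) ** (transpose Z ** Q 1)"
  shows "weak_rolling (there_and_rotated_back \<theta> W) r
    (\<lambda>t. if t \<le> 1 / 2 then Q (2 * t) else Z ** (Q (2 - 2 * t) ** K))"
    (is "weak_rolling ?P r ?R")
proof -
  have cQ: "continuous_on {0..1} Q" and Q0: "Q 0 = mat 1" using Q by (simp_all add: weak_rolling_def)
  obtain S where S: "finite S" "\<forall>t\<in>{0<..<1} - S. \<exists>v. (W has_vector_derivative v) (at t) \<and>
        (Q has_vector_derivative angular_velocity_matrix r v ** Q t) (at t)"
    using Q unfolding weak_rolling_def by (elim conjE exE)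
  have mid: "Z ** (Q 1 ** K) = Q 1"
    using rotation_matrix_inverse(2)[OF weak_rolling_rotation_matrix[OF Q, of 1]]
      rotation_matrix_inverse(2)[OF rotation_matrix_about_z[of \<theta>]]
    by (simp add: K_def Z_def matrix_mul_assoc)
  have "continuous_on {0..1} ?R"
  proof (rule continuous_on_cases_le)
    show "continuous_on {t \<in> {0..1}. t \<le> 1 / 2} (\<lambda>t. Q (2 * t))"
      by (rule continuous_on_compose2[OF cQ]) (auto intro!: continuous_intros)
    have "continuous_on {t \<in> {0..1}. 1 / 2 \<le> t} (\<lambda>t::real. Q (2 - 2 * t))"
      by (rule continuous_on_compose2[OF cQ]) (auto intro!: continuous_intros)
    then show "continuous_on {t \<in> {0..1}. 1 / 2 \<le> t} (\<lambda>t. Z ** (Q (2 - 2 * t) ** K))"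
      by (intro matrix_mult.continuous_on continuous_on_const)
    show "Q (2 * t) = Z ** (Q (2 - 2 * t) ** K)" if "t = 1 / 2" for t
      unfolding that using mid by simp
  qed (intro continuous_intros)
  moreover have "?R 0 = mat 1" using Q0 by simp
  \<comment> \<open>Besides the corner at 1/2, the exceptional times are those at which either half
    passes an exceptional point of \<open>W\<close>.\<close>
  moreover have "\<exists>v. (?P has_vector_derivative v) (at t) \<and>
        (?R has_vector_derivative angular_velocity_matrix r v ** ?R t) (at t)"
    if t: "t \<in> {0<..<1} - ({1 / 2} \<union> ((\<lambda>s. s / 2) ` S \<union> (\<lambda>s. 1 - s / 2) ` S))" for t
  proof -
    consider "t < 1 / 2" | "1 / 2 < t" using t by force
    then show ?thesis
    proof cases
      case 1
      have "2 * t \<in> {0<..<1} - S" using t 1 imageI[of "2 * t" S "\<lambda>s. s / 2"] by auto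
      then obtain v where v: "(W has_vector_derivative v) (at (2 * t))"
        "(Q has_vector_derivative angular_velocity_matrix r v ** Q (2 * t)) (at (2 * t))"
        using S(2) by blast
      have lin: "((\<lambda>t. 2 * t) has_vector_derivative 2) (at t)"
        by (auto intro!: derivative_eq_intros simp: has_real_derivative_iff_has_vector_derivative[symmetric])
      have "(?P has_vector_derivative 2 *\<^sub>R v) (at t)"
        by (rule has_vector_derivative_transform_within_open
            [OF vector_diff_chain_at[OF lin v(1)], of "{..<1 / 2}"])
           (use 1 in \<open>auto simp: there_and_rotated_back_left\<close>)
      moreover have "(?R has_vector_derivative 2 *\<^sub>R (angular_velocity_matrix r v ** Q (2 * t))) (at t)"
        by (rule has_vector_derivative_transform_within_open
            [OF vector_diff_chain_at[OF lin v(2)], of "{..<1 / 2}"])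
           (use 1 in auto)
      moreover have "2 *\<^sub>R (angular_velocity_matrix r v ** Q (2 * t))
          = angular_velocity_matrix r (2 *\<^sub>R v) ** ?R t"
        using 1 by (simp add: linear_scale[OF linear_angular_velocity_matrix] matrix_mult.scaleR_left)
      ultimately show ?thesis by auto
    next
      case 2
      let ?u = "2 - 2 * t"
      have "?u \<in> {0<..<1} - S" using t 2 imageI[of ?u S "\<lambda>s. 1 - s / 2"] by (auto simp: diff_divide_distrib)
      then obtain v where v: "(W has_vector_derivative v) (at ?u)"
        "(Q has_vector_derivative angular_velocity_matrix r v ** Q ?u) (at ?u)"
        using S(2) by blast
      have lin: "((\<lambda>t. 2 - 2 * t) has_vector_derivative - 2) (at t)"
        by (auto intro!: derivative_eq_intros simp: has_real_derivative_iff_has_vector_derivative[symmetric])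
      let ?w = "plane_rotation \<theta> *v ((- 2) *\<^sub>R v)"
      let ?A = "angular_velocity_matrix r"
      have "((\<lambda>t. (W 1 - plane_rotation \<theta> *v W 1) + plane_rotation \<theta> *v W (2 - 2 * t))
          has_vector_derivative 0 + ?w) (at t)"
        using vector_diff_chain_at[OF lin v(1)]
        by (intro has_vector_derivative_add has_vector_derivative_const
            bounded_linear.has_vector_derivative[OF matrix_vector_mul_bounded_linear]) (simp add: o_def)
      then have "(?P has_vector_derivative 0 + ?w) (at t)"
        by (rule has_vector_derivative_transform_within_open[of _ _ _ "{1 / 2<..}"])
           (use 2 in \<open>auto simp: there_and_rotated_back_right\<close>)
      moreover have "((\<lambda>t. Z ** (Q (2 - 2 * t) ** K)) has_vector_derivative
          Z ** (((- 2) *\<^sub>R (?A v ** Q ?u)) ** K)) (at t)"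
        using vector_diff_chain_at[OF lin v(2)]
        by (intro bounded_linear.has_vector_derivative[OF matrix_mult.bounded_linear_right]
            bounded_linear.has_vector_derivative[OF matrix_mult.bounded_linear_left])
           (simp add: o_def)
      then have "(?R has_vector_derivative Z ** (((- 2) *\<^sub>R (?A v ** Q ?u)) ** K)) (at t)"
        by (rule has_vector_derivative_transform_within_open[of _ _ _ "{1 / 2<..}"])
           (use 2 in auto)
      moreover have "Z ** (((- 2) *\<^sub>R (?A v ** Q ?u)) ** K) = ?A ?w ** ?R t"
      proof -
        have "?A ?w ** (Z ** (Q ?u ** K)) = (Z ** ?A ((- 2) *\<^sub>R v)) ** (Q ?u ** K)"
          by (simp only: Z_def matrix_mul_assoc angular_velocity_matrix_rotate)
        also have "\<dots> = Z ** (((- 2) *\<^sub>R (?A v ** Q ?u)) ** K)"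
          by (simp only: linear_scale[OF linear_angular_velocity_matrix] matrix_mult.scaleR_left
              matrix_mult.scaleR_right matrix_mul_assoc)
        finally show ?thesis using 2 by simp
      qed
      ultimately show ?thesis by auto
    qed
  qed
  ultimately show ?thesis
    unfolding weak_rolling_def using S(1)
    by (intro conjI exI[of _ "{1 / 2} \<union> ((\<lambda>s. s / 2) ` S \<union> (\<lambda>s. 1 - s / 2) ` S)"] ballI)
       simp_all
qed

lemma rolling_rotation_there_and_rotated_back:
  assumes "piecewise_holder_path W"
  fixes \<theta> r :: real
  defines "Z \<equiv> rotation_about_z \<theta>" and "A \<equiv> rolling_rotation W r"
  shows "rolling_rotation (there_and_rotated_back \<theta> W) r = Z ** transpose A ** transpose Z ** A"
proof -
  obtain Q where Q: "weak_rolling W r Q" using weak_rolling_exists[OF assms(1)] .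
  have "A = Q 1" unfolding A_def by (rule rolling_rotation_eq[OF assms(1) Q])
  moreover have "Q 0 = mat 1" using Q by (simp add: weak_rolling_def)
  ultimately show ?thesis
    unfolding rolling_rotation_eq[OF piecewise_holder_path_there_and_rotated_back[OF assms(1)]
      weak_rolling_there_and_rotated_back[OF Q]]
    by (simp add: Z_def matrix_mul_assoc)
qed

section \<open>Dependence on the radius\<close>

text \<open>Since \<open>1 / 0 = 0\<close>, the angular velocity vanishes. This supplies the left
  end point for the intermediate value theorem.\<close>

lemma rolling_rotation_radius_0:
  assumes P: "piecewise_holder_path \<gamma>"
  shows "rolling_rotation \<gamma> 0 = mat 1"
proof -
  obtain Q where Q: "weak_rolling \<gamma> 0 Q" using weak_rolling_exists[OF P] .
  then have c: "continuous_on {0..1} Q" "Q 0 = mat 1" by (simp_all add: weak_rolling_def)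
  obtain S where S: "finite S" "\<forall>t\<in>{0<..<1} - S. \<exists>v. (\<gamma> has_vector_derivative v) (at t) \<and>
        (Q has_vector_derivative angular_velocity_matrix 0 v ** Q t) (at t)"
    using Q unfolding weak_rolling_def by (elim conjE exE)
  have "(Q has_vector_derivative 0) (at t)" if "t \<in> {0<..<1} - S" for t
    using S(2) that by (auto simp: angular_velocity_matrix_eq matrix_mult.zero_left)
  then have "Q 1 = Q 0" by (intro continuous_const_if_zero_derivative[OF S(1) c(1)]) auto
  then show ?thesis using rolling_rotation_eq[OF P Q] c(2) by simp
qed

lemma piecewise_holder_path_speed_bounded:
  assumes P: "piecewise_holder_path \<gamma>"
  obtains S V where "finite S" "0 \<le> V"
    "\<And>t v. t \<in> {0<..<1} - S \<Longrightarrow> (\<gamma> has_vector_derivative v) (at t) \<Longrightarrow> norm v \<le> V"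
proof -
  obtain p m where p: "p 0 = 0" "p m = 1" "\<forall>i<m. p i < p (Suc i)"
    "\<forall>i<m. smooth_piece \<gamma> (p i) (p (Suc i))"
    using piecewise_holder_path_partition[OF P] by (elim exE conjE)
  let ?I = "\<lambda>i. {p i..p (Suc i)}"
  let ?B = "\<lambda>i. (\<lambda>t. vector_derivative \<gamma> (at t within ?I i)) ` ?I i"
  have "bounded (\<Union>i\<in>{..<m}. ?B i)"
  proof (intro bounded_UN finite_lessThan ballI)
    fix i assume "i \<in> {..<m}"
    then have "smooth_piece \<gamma> (p i) (p (Suc i))" using p(4) by simp
    from smooth_piece_derivative(2)[OF this] show "bounded (?B i)"
      by (intro compact_imp_bounded compact_continuous_image compact_Icc)
  qed
  then obtain V where V: "0 < V" "\<forall>x\<in>(\<Union>i\<in>{..<m}. ?B i). norm x \<le> V"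
    unfolding bounded_pos by (elim exE conjE)
  show thesis
  proof (rule that)
    show "finite (p ` {..m})" "0 \<le> V" using V by simp_all
    fix t v assume t: "t \<in> {0<..<1} - p ` {..m}" and v: "(\<gamma> has_vector_derivative v) (at t)"
    obtain i where i: "i < m" "t \<in> {p i<..<p (Suc i)}"
      by (rule partition_cases[of t p m]) (use t p(1,2) in simp, blast)
    then have "at t within ?I i = at t" by (simp add: at_within_Icc_at)
    then have "vector_derivative \<gamma> (at t within ?I i) = v" using v by (simp add: vector_derivative_at)
    then have "v \<in> ?B i" using i(2) by (intro image_eqI[of _ _ t]) simp_all
    then show "norm v \<le> V" using V(2) i(1) by (intro V(2)[rule_format] UN_I[of i]) simp_all
  qed
qed

text \<open>The radius enters the equation only through its inverse.
  \<open>transpose (Q t) ** R t\<close> starts at the identity and moves with speed at most a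
  constant times the difference of the inverse radii.\<close>

lemma rolling_rotation_lipschitz:
  assumes P: "piecewise_holder_path \<gamma>"
  obtains C where
    "\<And>r s. norm (rolling_rotation \<gamma> r - rolling_rotation \<gamma> s) \<le> C * \<bar>1 / r - 1 / s\<bar>"
proof -
  obtain S V where S: "finite S" and V: "0 \<le> V"
    "\<And>t v. t \<in> {0<..<1} - S \<Longrightarrow> (\<gamma> has_vector_derivative v) (at t) \<Longrightarrow> norm v \<le> V"
    by (rule piecewise_holder_path_speed_bounded[OF P]) blast
  obtain K where K: "0 < K" "\<And>(a::real^3^3) (b::real^3^3). norm (a ** b) \<le> norm a * norm b * K"
    using matrix_mult.pos_bounded by blast
  have mult_le: "norm (a ** b) \<le> x * y * K" if "norm a \<le> x" "norm b \<le> y" for a b :: "real^3^3" and x y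
    using K(1) that norm_ge_zero[of a]
    by (intro order_trans[OF K(2)] mult_right_mono mult_mono) (linarith | simp)+
  obtain L where L: "0 < L" "\<And>v. norm (angular_velocity_matrix 1 v) \<le> norm v * L"
    using bounded_linear.pos_bounded[OF bounded_linear_angular_velocity_matrix] by blast
  \<comment> \<open>Each 9 bounds a rotation, \<open>V * L\<close> the angular velocity at radius 1,
    and each \<open>K\<close> pays for one matrix product.\<close>
  let ?c = "9 * (V * L * 9 * K) * K"
  have c: "0 \<le> ?c" using V K L by simp
  have "norm (rolling_rotation \<gamma> r - rolling_rotation \<gamma> s) \<le> (9 * ?c * K) * \<bar>1 / r - 1 / s\<bar>"
    for r s
  proof -
    obtain Q where Q: "weak_rolling \<gamma> r Q" using weak_rolling_exists[OF P] .
    obtain R where R: "weak_rolling \<gamma> s R" using weak_rolling_exists[OF P] .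
    let ?f = "\<lambda>t. transpose (Q t) ** R t"
    obtain T where T: "finite T" "\<And>t. t \<in> {0<..<1} - T \<Longrightarrow> \<exists>v. (\<gamma> has_vector_derivative v) (at t) \<and>
       (?f has_vector_derivative
          (1 / s - 1 / r) *\<^sub>R (transpose (Q t) ** (angular_velocity_matrix 1 v ** R t))) (at t)"
      by (rule weak_rolling_transpose_mult[OF Q R]) blast
    \<comment> \<open>A total function is needed as integrand; this one avoids choosing a velocity
      \<open>v\<close> for each time.\<close>
    define D where "D t = vector_derivative ?f (at t)" for t
    have D: "(?f has_vector_derivative D t) (at t) \<and> norm (D t) \<le> \<bar>1 / r - 1 / s\<bar> * ?c"
      if t: "t \<in> {0<..<1} - (S \<union> T)" for t
    proof -
      obtain v where v: "(\<gamma> has_vector_derivative v) (at t)"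
        and f: "(?f has_vector_derivative
          (1 / s - 1 / r) *\<^sub>R (transpose (Q t) ** (angular_velocity_matrix 1 v ** R t))) (at t)"
        using T(2)[of t] t by blast
      have Dt: "D t = (1 / s - 1 / r) *\<^sub>R (transpose (Q t) ** (angular_velocity_matrix 1 v ** R t))"
        using vector_derivative_at[OF f] by (simp add: D_def)
      have rot: "norm (transpose (Q t)) \<le> 9" "norm (R t) \<le> 9"
        using weak_rolling_rotation_matrix[OF Q, of t] weak_rolling_rotation_matrix[OF R, of t] t
        by (auto intro!: rotation_matrix_norm_le rotation_matrix_transpose)
      have "norm (angular_velocity_matrix 1 v) \<le> V * L"
      proof -
        have "norm v \<le> V" using V(2)[OF _ v] t by simp
        then have "norm v * L \<le> V * L" using L(1) by (intro mult_right_mono) simp_all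
        then show ?thesis using L(2)[of v] by linarith
      qed
      then have "norm (angular_velocity_matrix 1 v ** R t) \<le> V * L * 9 * K"
        using rot(2) by (rule mult_le)
      with rot(1) have "norm (transpose (Q t) ** (angular_velocity_matrix 1 v ** R t)) \<le> ?c"
        by (rule mult_le)
      then have "norm (D t) \<le> \<bar>1 / r - 1 / s\<bar> * ?c"
        unfolding Dt norm_scaleR abs_minus_commute[of "1 / s"] by (intro mult_left_mono) auto
      then show ?thesis using f Dt by simp
    qed
    have "(D has_integral (?f 1 - ?f 0)) {0..1}"
    proof (rule fundamental_theorem_of_calculus_interior_strong)
      show "finite (S \<union> T)" using S T by simp
      show "continuous_on {0..1} ?f"
        using Q R unfolding weak_rolling_def
        by (intro matrix_mult.continuous_on bounded_linear.continuous_on[OF bounded_linear_transpose])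
           simp_all
    qed (use D in auto)
    then have "norm (?f 1 - ?f 0) \<le> \<bar>1 / r - 1 / s\<bar> * ?c * measure lborel {0..1::real}"
      by (rule has_integral_bound_real[of _ "insert 0 (insert 1 (S \<union> T))", rotated 2])
         (use D S T c in auto)
    moreover have "?f 0 = mat 1" using Q R by (simp add: weak_rolling_def)
    ultimately have f1: "norm (mat 1 - ?f 1) \<le> \<bar>1 / r - 1 / s\<bar> * ?c"
      by (simp add: norm_minus_commute)
    have rot: "rotation_matrix (Q 1)" using weak_rolling_rotation_matrix[OF Q] by simp
    have "Q 1 - R 1 = Q 1 ** (mat 1 - ?f 1)"
      using rotation_matrix_inverse(2)[OF rot] by (simp add: matrix_mult.diff_right matrix_mul_assoc)
    also have "norm \<dots> \<le> 9 * (\<bar>1 / r - 1 / s\<bar> * ?c) * K"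
      using rotation_matrix_norm_le[OF rot] f1 by (rule mult_le)
    finally show ?thesis
      unfolding rolling_rotation_eq[OF P Q] rolling_rotation_eq[OF P R] by (simp add: mult_ac)
  qed
  then show thesis by (rule that)
qed

section \<open>Which angles occur as the radius varies\<close>

theorem theorem2:
  fixes j :: nat and \<beta> \<phi> :: real and W P :: "real \<Rightarrow> real^2"
  assumes "j \<ge> 2"
    and "0 < \<beta>" and "\<beta> < pi / real j"
    and "\<phi> = \<beta> \<or> \<phi> = - \<beta>"
    and "piecewise_holder_path W"
    and "P = there_and_rotated_back \<phi> W"
    and "\<not> n_path 1 W"
    and "\<not> (\<exists>r>0. \<exists>\<theta>. rolling_rotation W r = rotation_about_z \<theta>)"
  shows "\<exists>n>j. n_path n P"
proof -
  have W: "piecewise_holder_path W" and PW: "P = there_and_rotated_back \<phi> W"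
    and notz: "\<And>r \<theta>. r > 0 \<Longrightarrow> rolling_rotation W r \<noteq> rotation_about_z \<theta>"
    using assms(5,6,8) by auto
  have P: "piecewise_holder_path P"
    unfolding PW by (rule piecewise_holder_path_there_and_rotated_back[OF W])
  have cos: "cos \<phi> = cos \<beta>" using assms(4) by auto
  have "\<beta> * real j < pi" using assms(1,3) by (simp add: field_simps)
  moreover from this have "\<beta> * 2 < pi" using assms(1,2) mult_left_mono[of 2 "real j" \<beta>] by linarith
  ultimately have \<beta>: "0 < \<beta>" "\<beta> < pi / 2" "real j * \<beta> < pi"
    using assms(2) by (auto simp: mult.commute)
  \<comment> \<open>The parameter is the inverse radius, in which the rotation is Lipschitz and
    which can be 0.\<close>
  define A where "A \<kappa> = rolling_rotation W (1 / \<kappa>)" for \<kappa> :: real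
  define u where "u \<kappa> = (1 + cos \<beta>) / 2 + (1 - cos \<beta>) / 2 * A \<kappa> $ 3 $ 3" for \<kappa>
  define M where "M \<kappa> = rolling_rotation P (1 / \<kappa>)" for \<kappa> :: real
  have rotA: "rotation_matrix (A \<kappa>)" and rotM: "rotation_matrix (M \<kappa>)" for \<kappa>
    unfolding A_def M_def by (rule rotation_matrix_rolling_rotation W P)+
  have cos1: "cos \<beta> < 1" using \<beta> cos_monotone_0_pi[of 0 \<beta>] by simp
  \<comment> \<open>With u = cos \<alpha> the right-hand side is 1 + 2 cos (2 \<alpha>), the trace
    of a rotation by 2 \<alpha>.\<close>
  have tr: "trace (M \<kappa>) = 4 * (u \<kappa>)^2 - 1" for \<kappa>
    using trace_commutator_rotation_about_z[OF rotA[of \<kappa>], of \<phi>]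
    unfolding M_def PW rolling_rotation_there_and_rotated_back[OF W]
    by (simp add: A_def u_def cos)
  have u_bounds: "cos \<beta> \<le> u \<kappa>" "u \<kappa> \<le> 1" for \<kappa>
  proof -
    have a: "-1 \<le> A \<kappa> $ 3 $ 3" "A \<kappa> $ 3 $ 3 \<le> 1"
      using rotation_matrix_entry_le[OF rotA[of \<kappa>], of 3 3] by auto
    have "(1 - cos \<beta>) / 2 * (- 1) \<le> (1 - cos \<beta>) / 2 * A \<kappa> $ 3 $ 3"
      "(1 - cos \<beta>) / 2 * A \<kappa> $ 3 $ 3 \<le> (1 - cos \<beta>) / 2 * 1"
      using a cos1 by (intro mult_left_mono; simp)+
    then show "cos \<beta> \<le> u \<kappa>" "u \<kappa> \<le> 1" by (simp_all add: u_def field_simps)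
  qed
  have u_less: "u \<kappa> < 1" if "\<kappa> > 0" for \<kappa>
  proof (rule ccontr)
    assume "\<not> u \<kappa> < 1"
    then have "u \<kappa> = 1" using u_bounds(2)[of \<kappa>] by simp
    then have "(1 - cos \<beta>) * (A \<kappa> $ 3 $ 3 - 1) = 0" by (simp add: u_def field_simps)
    then have "A \<kappa> $ 3 $ 3 = 1" using cos1 by simp
    then obtain \<theta> where "A \<kappa> = rotation_about_z \<theta>" by (rule rotation_matrix_fixing_z[OF rotA])
    then show False using notz[of "1 / \<kappa>" \<theta>] that by (simp add: A_def)
  qed
  \<comment> \<open>\<open>2\<alpha>\<close> is the rotation angle of \<open>M \<kappa>\<close>.\<close>
  have pow: "matrix_pow (M \<kappa>) k = mat 1 \<longleftrightarrow> cos (real k * (2 * \<alpha>)) = 1"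
    if "u \<kappa> = cos \<alpha>" "0 < \<alpha>" "\<alpha> < pi / 2" for \<kappa> \<alpha> k
  proof (rule rotation_matrix_pow_eq_mat_1_iff[OF rotM])
    show "trace (M \<kappa>) = 1 + 2 * cos (2 * \<alpha>)"
      unfolding tr that(1) cos_double_cos by simp
    have "0 < sin (2 * \<alpha>)" using that by (intro sin_gt_zero) auto
    then show "sin (2 * \<alpha>) \<noteq> 0" by simp
  qed
  have no_small: "matrix_pow (rolling_rotation P r) k \<noteq> mat 1" if "r > 0" "1 \<le> k" "k \<le> j" for r k
  proof -
    let ?\<kappa> = "1 / r" and ?\<alpha> = "arccos (u (1 / r))"
    have "\<bar>u ?\<kappa>\<bar> \<le> 1" using u_bounds[of ?\<kappa>] cos_ge_minus_one[of \<beta>] by linarith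
    then have \<alpha>: "u ?\<kappa> = cos ?\<alpha>" "0 \<le> ?\<alpha>" "?\<alpha> \<le> pi"
      using arccos_lbound[of "u ?\<kappa>"] arccos_ubound[of "u ?\<kappa>"] cos_arccos_abs by (simp_all add: abs_le_iff)
    have "?\<alpha> \<noteq> 0" using \<alpha>(1) u_less[of ?\<kappa>] that(1) by force
    then have pos: "0 < ?\<alpha>" using \<alpha> by simp
    have le: "?\<alpha> \<le> \<beta>"
      using u_bounds(1)[of ?\<kappa>] \<alpha> \<beta> cos_mono_le_eq[of \<beta> ?\<alpha>] by simp
    \<comment> \<open>As k \<alpha> stays strictly between 0 and \<pi>, the total angle 2 k \<alpha>
      stays strictly between 0 and a full turn.\<close>
    have "real k * ?\<alpha> \<le> real j * \<beta>" using that le pos by (intro mult_mono) auto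
    then have "0 < real k * ?\<alpha>" "real k * ?\<alpha> < pi" using pos that \<beta> by auto
    then have "0 < sin (real k * ?\<alpha>)" by (rule sin_gt_zero)
    then have "cos (2 * (real k * ?\<alpha>)) < 1" by (simp add: cos_double_sin)
    then have "cos (real k * (2 * ?\<alpha>)) \<noteq> 1" by (simp add: mult_ac)
    then show ?thesis
      using pow[OF \<alpha>(1) pos, of k] le \<beta> by (simp add: M_def)
  qed
  obtain C where C: "\<And>r s. norm (rolling_rotation W r - rolling_rotation W s) \<le> C * \<bar>1 / r - 1 / s\<bar>"
    using rolling_rotation_lipschitz[OF W] by blast
  \<comment> \<open>Here \<open>1 / (1 / x) = x\<close> holds for \<open>x = 0\<close> as well, so
    the estimate includes the infinite radius.\<close>
  have A_lip: "norm (A x - A y) \<le> C * \<bar>x - y\<bar>" for x y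
    using C[of "1 / x" "1 / y"] by (simp add: A_def)
  have "continuous_on UNIV A"
  proof (rule continuous_onI)
    fix x e :: real assume "0 < e"
    have "norm (A y - A x) < e" if "\<bar>y - x\<bar> < e / (\<bar>C\<bar> + 1)" for y
    proof -
      have "norm (A y - A x) \<le> (\<bar>C\<bar> + 1) * \<bar>y - x\<bar>"
        by (rule order_trans[OF A_lip]) (intro mult_right_mono; simp)
      also have "\<dots> < e" using that by (simp add: field_simps)
      finally show ?thesis .
    qed
    then show "\<exists>d>0. \<forall>y\<in>UNIV. dist y x < d \<longrightarrow> dist (A y) (A x) \<le> e"
      using \<open>0 < e\<close>
      by (intro exI[of _ "e / (\<bar>C\<bar> + 1)"]) (auto simp: dist_norm intro: less_imp_le)
  qed
  then have cont: "continuous_on {0..1} u"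
    unfolding u_def
    by (intro continuous_intros continuous_on_component) (auto intro: continuous_on_subset)
  \<comment> \<open>With \<open>x / 0 = 0\<close>, the value \<open>\<kappa> = 0\<close> is a ball that does not rotate, i.e. infinite radius.\<close>
  have "A 0 = mat 1" by (simp add: A_def rolling_rotation_radius_0[OF W])
  then have u0: "u 0 = 1" by (simp add: u_def mat_def field_simps)
  \<comment> \<open>The value at 1 is merely some value of \<open>u\<close> below 1. For large
    \<open>n\<close> the number cos (\<pi>/n) lies between it and \<open>u 0\<close>, and
    \<open>3 \<le> n\<close> puts \<pi>/n below \<pi>/2, as \<open>pow\<close> requires.\<close>
  obtain n :: nat where n: "3 \<le> n" "u 1 \<le> cos (pi / n)"
  proof -
    have "((\<lambda>n. cos (pi / real n)) \<longlonglongrightarrow> cos 0)"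
      by (intro tendsto_cos lim_const_over_n)
    then have "eventually (\<lambda>n. u 1 < cos (pi / real n)) sequentially"
      using u_less[of 1] by (intro order_tendstoD) auto
    then have "eventually (\<lambda>n. 3 \<le> n \<and> u 1 \<le> cos (pi / real n)) sequentially"
      by (intro eventually_conj eventually_ge_at_top) (auto elim: eventually_mono)
    then show thesis using that eventually_happens' sequentially_bot by blast
  qed
  obtain \<kappa> where \<kappa>: "0 \<le> \<kappa>" "u \<kappa> = cos (pi / n)"
    using IVT2'[of u 1 "cos (pi / n)" 0] n u0 cont by auto
  have "pi / n < pi / 2" "0 < pi / n" "pi / n \<le> pi" using n by (simp_all add: field_simps)
  moreover from this have "cos (pi / n) < 1" using cos_monotone_0_pi[of 0 "pi / n"] by simp
  \<comment> \<open>The parameter 0 is excluded because \<open>u 0 = 1\<close> exceeds cos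
    (\<pi>/n); the total angle n * 2 \<pi>/n is one full turn.\<close>
  ultimately have "0 < \<kappa>" "matrix_pow (M \<kappa>) n = mat 1"
    using \<kappa> u0 pow[OF \<kappa>(2), of n] n by (auto simp: less_le)
  then have ex: "1 \<le> n \<and> (\<exists>r>0. matrix_pow (rolling_rotation P r) n = mat 1)"
    using n by (intro conjI exI[of _ "1 / \<kappa>"]) (simp_all add: M_def)
  \<comment> \<open>The exponent \<open>n\<close> only shows that some power works; a smaller one
    may work for another radius. The least such exponent is what \<open>n_path\<close> asks for, and
    \<open>no_small\<close> puts it above \<open>j\<close>.\<close>
  define N where "N = (LEAST n. 1 \<le> n \<and> (\<exists>r>0. matrix_pow (rolling_rotation P r) n = mat 1))"
  have N: "1 \<le> N \<and> (\<exists>r>0. matrix_pow (rolling_rotation P r) N = mat 1)"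
    unfolding N_def by (rule LeastI[of _ n]) (rule ex)
  have "\<not> (1 \<le> k \<and> (\<exists>r>0. matrix_pow (rolling_rotation P r) k = mat 1))" if "k < N" for k
    using that unfolding N_def by (rule not_less_Least)
  then have "n_path N P" unfolding n_path_def using P N by blast
  moreover have "j < N" using N no_small by (meson not_le)
  ultimately show ?thesis by blast
qed

end
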